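(* Let $I$ be an ideal of $B(H)$ for which there exist a nonsummable sequence $\xi\in\Sigma(I)$ and a monotone sequence of indices $\{p_l\}_{l\in\mathbb N}\subset\mathbb N$ such that for every $\chi\in\Sigma(I)$ there is an associated $m\in\mathbb N$ (depending on $\chi$) for which $$\Big(\frac{\chi}{\xi_a}\Big)_{mp_l}=\frac{\chi_{mp_l}}{(\xi_a)_{mp_l}}\longrightarrow0\quad\text{as } l\to\infty.$$ Then $\dim\frac{I}{[I,B(H)]}=\infty$.
   Context: $H$ is a complex separable infinite-dimensional Hilbert space. "Ideal" means a proper two-sided ideal of $B(H)$; every such ideal is contained in the compact operators. $[I,B(H)]$ is the linear span of the commutators $XY-YX$ with $X\in I$, $Y\in B(H)$. For compact $X$, $s(X)$ is its sequence of $s$-numbers (singular values in decreasing order, completed by zeros), and $\Sigma(I)=\{s(X)\mid X\in I\}$ is the characteristic set of $I$, a set of nonincreasing sequences of nonnegative reals (indexed by $n\ge1$) converging to $0$. For a sequence $\xi$, $\xi_a:=\langle\frac1n\sum_{j=1}^n\xi_j\rangle_{n\ge1}$ is its sequence of arithmetic means. *)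

theory Defs
  imports "HOL-Analysis.Analysis"
begin

section \<open>Complex Hilbert spaces\<close>

class complex_vector = ab_group_add +
  fixes scaleC :: "complex \<Rightarrow> 'a \<Rightarrow> 'a"  (infixr "*\<^sub>C" 75)
  assumes scaleC_add_right: "a *\<^sub>C (x + y) = a *\<^sub>C x + a *\<^sub>C y"
    and scaleC_add_left: "(a + b) *\<^sub>C x = a *\<^sub>C x + b *\<^sub>C x"
    and scaleC_scaleC: "a *\<^sub>C b *\<^sub>C x = (a * b) *\<^sub>C x"
    and scaleC_one: "1 *\<^sub>C x = x"

global_interpretation complex_vector:
  vector_space "scaleC :: complex \<Rightarrow> 'a \<Rightarrow> 'a::complex_vector"
  by unfold_locales (rule scaleC_add_right scaleC_add_left scaleC_scaleC scaleC_one)+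

text \<open>The inner product is linear in the first argument. The norm, and hence the metric
  and the topology, is the one induced by the inner product.\<close>

class complex_inner = complex_vector + real_normed_vector +
  fixes cinner :: "'a \<Rightarrow> 'a \<Rightarrow> complex"
  assumes scaleR_scaleC: "r *\<^sub>R x = complex_of_real r *\<^sub>C x"
    and cinner_commute: "cinner x y = cnj (cinner y x)"
    and cinner_add_left: "cinner (x + y) z = cinner x z + cinner y z"
    and cinner_scaleC_left: "cinner (a *\<^sub>C x) y = a * cinner x y"
    and norm_eq_sqrt_cinner: "norm x = sqrt (Re (cinner x x))"

class chilbert_space = complex_inner + complete_space

lemma norm_scaleC:
  "norm (a *\<^sub>C x) = cmod a * norm x" for x :: "'a::complex_inner"
proof -
  have "cinner (a *\<^sub>C x) (a *\<^sub>C x) = a * cnj (cinner (a *\<^sub>C x) x)"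
    by (metis cinner_commute cinner_scaleC_left)
  also have "\<dots> = (a * cnj a) * cnj (cinner x x)"
    by (simp add: cinner_scaleC_left)
  also have "\<dots> = complex_of_real ((cmod a)\<^sup>2) * cnj (cinner x x)"
    by (simp only: complex_norm_square)
  finally have "Re (cinner (a *\<^sub>C x) (a *\<^sub>C x)) = (cmod a)\<^sup>2 * Re (cinner x x)"
    by simp
  then show ?thesis
    by (simp add: norm_eq_sqrt_cinner real_sqrt_mult)
qed


section \<open>The algebra of bounded operators\<close>

text \<open>The type \<open>'h bop\<close> is the algebra of bounded complex-linear operators on \<open>'h\<close>,
  with composition as multiplication.\<close>

typedef (overloaded) 'h bop =
  "{f :: 'h::complex_inner \<Rightarrow> 'h. bounded_linear f \<and> (\<forall>c x. f (c *\<^sub>C x) = c *\<^sub>C f x)}"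
  morphisms bop_apply Bop
  by (rule exI[of _ "\<lambda>x. 0"]) simp

setup_lifting type_definition_bop

instantiation bop :: (complex_inner) ring
begin

lift_definition zero_bop :: "'a bop" is "\<lambda>x. 0" by simp

lift_definition plus_bop :: "'a bop \<Rightarrow> 'a bop \<Rightarrow> 'a bop" is "\<lambda>f g x. f x + g x"
  by (auto intro: bounded_linear_add simp: scaleC_add_right)

lift_definition uminus_bop :: "'a bop \<Rightarrow> 'a bop" is "\<lambda>f x. - f x"
  by (auto intro: bounded_linear_minus)

lift_definition minus_bop :: "'a bop \<Rightarrow> 'a bop \<Rightarrow> 'a bop" is "\<lambda>f g x. f x - g x"
  by (auto intro: bounded_linear_sub simp: complex_vector.scale_right_diff_distrib)

lift_definition times_bop :: "'a bop \<Rightarrow> 'a bop \<Rightarrow> 'a bop" is "\<lambda>f g x. f (g x)"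
  by (auto intro: bounded_linear_compose)

instance
  by standard
    (transfer; auto simp: fun_eq_iff linear_add dest!: bounded_linear.linear)+

end

instantiation bop :: (complex_inner) complex_vector
begin

lift_definition scaleC_bop :: "complex \<Rightarrow> 'a bop \<Rightarrow> 'a bop" is "\<lambda>c f x. c *\<^sub>C f x"
proof (intro conjI allI)
  fix c :: complex and f :: "'a \<Rightarrow> 'a"
  assume f: "bounded_linear f \<and> (\<forall>c x. f (c *\<^sub>C x) = c *\<^sub>C f x)"
  have "bounded_linear (\<lambda>x::'a. c *\<^sub>C x)"
    by (rule bounded_linear_intro[of _ "cmod c"])
      (simp_all add: scaleC_add_right scaleR_scaleC scaleC_scaleC norm_scaleC mult.commute)
  then show "bounded_linear (\<lambda>x. c *\<^sub>C f x)"
    using f by (auto intro: bounded_linear_compose)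
  show "c *\<^sub>C f (d *\<^sub>C x) = d *\<^sub>C c *\<^sub>C f x" for d x
    using f by (simp add: scaleC_scaleC mult.commute)
qed

instance
  by standard
    (transfer; auto simp: fun_eq_iff scaleC_add_right scaleC_add_left scaleC_scaleC scaleC_one)+

end

definition adjoint_op :: "'h::chilbert_space bop \<Rightarrow> 'h bop" where
  "adjoint_op X = (THE Y. \<forall>x y. cinner (bop_apply X x) y = cinner x (bop_apply Y y))"

definition proper_ideal :: "'h::complex_inner bop set \<Rightarrow> bool" where
  "proper_ideal I \<longleftrightarrow>
     0 \<in> I \<and> (\<forall>X\<in>I. \<forall>Y\<in>I. X + Y \<in> I) \<and> (\<forall>X\<in>I. \<forall>Y. X * Y \<in> I \<and> Y * X \<in> I) \<and> I \<noteq> UNIV"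

definition commutator_space :: "'h::complex_inner bop set \<Rightarrow> 'h bop set" where
  "commutator_space I = complex_vector.span {X * Y - Y * X | X Y. X \<in> I}"


section \<open>Singular numbers\<close>

text \<open>All sequences below are indexed by \<open>n \<ge> 1\<close>; the unused entry at index \<open>0\<close> is fixed to
  be \<open>0\<close>.

  The singular values of a compact operator \<open>X\<close> are the eigenvalues of the positive square
  root of \<open>X\<^sup>*X\<close>, that is, the numbers \<open>\<sigma> \<ge> 0\<close> such that \<open>\<sigma>\<^sup>2\<close> is an eigenvalue of \<open>X\<^sup>*X\<close>.
  In the sequence of s-numbers each \<open>\<sigma> > 0\<close> occurs as often as the dimension of its
  eigenspace (zero times, if it is not a singular value). If there are infinitely many positive
  singular values, monotonicity leaves no room for a zero; otherwise the sequence ends in zeros.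
  This determines the sequence uniquely, see \<open>s_number_seq_unique\<close> below; it exists for every
  compact \<open>X\<close>, in particular for every element of a proper ideal when the space is separable.\<close>

definition sv_eigenspace :: "'h::chilbert_space bop \<Rightarrow> real \<Rightarrow> 'h set" where
  "sv_eigenspace X \<sigma> = {v. bop_apply (adjoint_op X * X) v = complex_of_real (\<sigma>\<^sup>2) *\<^sub>C v}"

definition is_s_number_seq :: "'h::chilbert_space bop \<Rightarrow> (nat \<Rightarrow> real) \<Rightarrow> bool" where
  "is_s_number_seq X s \<longleftrightarrow>
     s 0 = 0 \<and> (\<forall>n. 0 \<le> s n) \<and> antimono_on {1..} s \<and>
     (\<forall>\<sigma>>0. finite {n. s n = \<sigma>} \<and> card {n. s n = \<sigma>} = complex_vector.dim (sv_eigenspace X \<sigma>))"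

definition s_numbers :: "'h::chilbert_space bop \<Rightarrow> nat \<Rightarrow> real" where
  "s_numbers X = (THE s. is_s_number_seq X s)"

definition characteristic_set :: "'h::chilbert_space bop set \<Rightarrow> (nat \<Rightarrow> real) set" where
  "characteristic_set I = s_numbers ` I"

definition arith_mean :: "(nat \<Rightarrow> real) \<Rightarrow> nat \<Rightarrow> real" where
  "arith_mean \<xi> n = (\<Sum>j=1..n. \<xi> j) / real n"

lemma s_number_seq_unique:
  assumes s: "is_s_number_seq X s" and t: "is_s_number_seq X t"
  shows "s = t"
proof -
  have no_less: "\<not> v n < u n"
    if u: "is_s_number_seq X u" and v: "is_s_number_seq X v" and eq: "\<forall>k<n. u k = v k" for u v n
  proof
    assume less: "v n < u n"
    define a where "a = u n"
    have a: "a > 0"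
      using less v by (auto simp: a_def is_s_number_seq_def intro: le_less_trans)
    have n: "n \<ge> 1"
      using less u v by (cases n) (auto simp: is_s_number_seq_def)
    have tail: "v k < a" if "k \<ge> n" for k
    proof -
      have "v k \<le> v n"
        using v n that by (auto simp: is_s_number_seq_def monotone_on_def)
      then show ?thesis using less by (simp add: a_def)
    qed
    have "{k. v k = a} \<subseteq> {k. u k = a} - {n}"
    proof
      fix k assume k: "k \<in> {k. v k = a}"
      then have "k < n" using tail[of k] by (cases "k < n") auto
      then show "k \<in> {k. u k = a} - {n}" using eq k by simp
    qed
    moreover have "finite {k. u k = a}"
      using u a by (simp add: is_s_number_seq_def)
    ultimately have "card {k. v k = a} \<le> card ({k. u k = a} - {n})"
      by (auto intro: card_mono)
    also have "\<dots> < card {k. u k = a}"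
      using \<open>finite {k. u k = a}\<close> by (intro card_Diff1_less) (auto simp: a_def)
    finally show False
      using u v a by (simp add: is_s_number_seq_def)
  qed
  have "s n = t n" for n
  proof (induction n rule: less_induct)
    case (less n)
    have "\<not> t n < s n" using less by (intro no_less s t) auto
    moreover have "\<not> s n < t n" using less by (intro no_less s t) auto
    ultimately show ?case by simp
  qed
  then show ?thesis by blast
qed


section \<open>Quotient spaces and their dimension\<close>

definition vcoset :: "'a::complex_vector set \<Rightarrow> 'a \<Rightarrow> 'a set" where
  "vcoset W x = (\<lambda>w. x + w) ` W"

definition quotient_space :: "'a::complex_vector set \<Rightarrow> 'a set \<Rightarrow> 'a set set" where
  "quotient_space V W = vcoset W ` V"

definition coset_add :: "'a::complex_vector set \<Rightarrow> 'a set \<Rightarrow> 'a set" where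
  "coset_add A B = {a + b | a b. a \<in> A \<and> b \<in> B}"

text \<open>Adding \<open>W\<close> only matters for \<open>c = 0\<close>.\<close>

definition coset_scale :: "'a::complex_vector set \<Rightarrow> complex \<Rightarrow> 'a set \<Rightarrow> 'a set" where
  "coset_scale W c A = {c *\<^sub>C a + w | a w. a \<in> A \<and> w \<in> W}"

inductive_set quotient_span :: "'a::complex_vector set \<Rightarrow> 'a set set \<Rightarrow> 'a set set"
  for W :: "'a set" and F :: "'a set set"
  where
    zero: "W \<in> quotient_span W F"
  | base: "A \<in> F \<Longrightarrow> A \<in> quotient_span W F"
  | add: "A \<in> quotient_span W F \<Longrightarrow> B \<in> quotient_span W F \<Longrightarrow> coset_add A B \<in> quotient_span W F"
  | scale: "A \<in> quotient_span W F \<Longrightarrow> coset_scale W c A \<in> quotient_span W F"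

definition infinite_dim_quotient :: "'a::complex_vector set \<Rightarrow> 'a set \<Rightarrow> bool" where
  "infinite_dim_quotient V W \<longleftrightarrow>
     \<not> (\<exists>F. finite F \<and> F \<subseteq> quotient_space V W \<and> quotient_span W F = quotient_space V W)"

lemma coset_add_vcoset:
  assumes W: "complex_vector.subspace W"
  shows "coset_add (vcoset W x) (vcoset W y) = vcoset W (x + y)"
proof
  show "coset_add (vcoset W x) (vcoset W y) \<subseteq> vcoset W (x + y)"
  proof
    fix z assume "z \<in> coset_add (vcoset W x) (vcoset W y)"
    then obtain u v where uv: "u \<in> W" "v \<in> W" and z: "z = (x + u) + (y + v)"
      by (auto simp: coset_add_def vcoset_def)
    have "z = (x + y) + (u + v)" by (simp add: z algebra_simps)
    then show "z \<in> vcoset W (x + y)"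
      unfolding vcoset_def using complex_vector.subspace_add[OF W uv] by blast
  qed
  show "vcoset W (x + y) \<subseteq> coset_add (vcoset W x) (vcoset W y)"
  proof
    fix z assume "z \<in> vcoset W (x + y)"
    then obtain u where u: "u \<in> W" and z: "z = x + y + u" by (auto simp: vcoset_def)
    have "x + u \<in> vcoset W x" using u by (simp add: vcoset_def)
    moreover have "y \<in> vcoset W y"
      using complex_vector.subspace_0[OF W] unfolding vcoset_def by (rule rev_image_eqI) simp
    moreover have "z = (x + u) + y" by (simp add: z algebra_simps)
    ultimately show "z \<in> coset_add (vcoset W x) (vcoset W y)"
      unfolding coset_add_def by blast
  qed
qed

lemma coset_scale_vcoset:
  assumes W: "complex_vector.subspace W"
  shows "coset_scale W c (vcoset W x) = vcoset W (c *\<^sub>C x)"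
proof
  show "coset_scale W c (vcoset W x) \<subseteq> vcoset W (c *\<^sub>C x)"
  proof
    fix z assume "z \<in> coset_scale W c (vcoset W x)"
    then obtain u v where uv: "u \<in> W" "v \<in> W" and z: "z = c *\<^sub>C (x + u) + v"
      by (auto simp: coset_scale_def vcoset_def)
    have "z = c *\<^sub>C x + (c *\<^sub>C u + v)" by (simp add: z scaleC_add_right add.assoc)
    moreover have "c *\<^sub>C u + v \<in> W"
      using W uv by (intro complex_vector.subspace_add complex_vector.subspace_scale)
    ultimately show "z \<in> vcoset W (c *\<^sub>C x)"
      unfolding vcoset_def by blast
  qed
  show "vcoset W (c *\<^sub>C x) \<subseteq> coset_scale W c (vcoset W x)"
  proof
    fix z assume "z \<in> vcoset W (c *\<^sub>C x)"
    then obtain u where u: "u \<in> W" and z: "z = c *\<^sub>C x + u" by (auto simp: vcoset_def)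
    have "x \<in> vcoset W x"
      using complex_vector.subspace_0[OF W] unfolding vcoset_def by (rule rev_image_eqI) simp
    then show "z \<in> coset_scale W c (vcoset W x)"
      unfolding coset_scale_def using u z by blast
  qed
qed

end

theory Submission
  imports Defs
begin

text \<open>The obstruction to lying in \<open>[I, B(H)]\<close> is the trace on finite-dimensional subspaces. Suppose that
a subspace of dimension \<open>d\<close> is almost reduced by \<open>X\<close>, with error \<open>\<epsilon>\<close>. The commutator of the
compressions of \<open>X\<close> and \<open>Y\<close> to it has trace \<open>0\<close>, so the compression of \<open>XY - YX\<close> has trace of
order \<open>d \<epsilon>\<close>. A subspace that contains the first \<open>n\<close> right singular vectors of \<open>X\<close> and their
images is almost reduced by \<open>X\<close> with error \<open>s\<^sub>n(X)\<close>. Let \<open>R \<in> [I, B(H)]\<close> be diagonal in an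
orthonormal basis \<open>b\<close>, with entries \<open>t\<^sub>j\<close> bounded by \<open>M \<xi>\<^sub>j\<close>. A subspace of dimension \<open>O(n)\<close>
that contains \<open>b\<^sub>1, \<dots>, b\<^sub>n\<close> and the singular vectors of all the operators of \<open>I\<close> in a
representation of \<open>R\<close> by commutators then yields
\<open>\<bar>t\<^sub>1 + \<dots> + t\<^sub>n\<bar> \<le> C n s\<^sub>n(Z)\<close> with a single \<open>Z \<in> I\<close>; this is
\<open>commutator_space_diagonal_estimate\<close>. That one \<open>Z\<close> suffices is \<open>ideal_s_numbers_finite\<close>.

Infinitely many classes come from a colouring of the indices by natural numbers. Let \<open>T\<^sub>k\<close> be the
diagonal operator with entry \<open>\<xi>\<^sub>j\<close> where \<open>j\<close> has colour \<open>k\<close> and \<open>0\<close> elsewhere; it lies in \<open>I\<close>.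
Since \<open>\<xi>\<close> is not summable, a long enough block of indices outweighs everything before it. So the
colours can be assigned in blocks such that for every \<open>k\<close> and every \<open>m\<close> there are infinitely many
\<open>l\<close> for which almost all of \<open>\<xi>\<^sub>1 + \<dots> + \<xi>\<^sub>n\<close>, \<open>n = m p\<^sub>l\<close>, sits on colour \<open>k\<close>; this is
\<open>colouring_concentrating_mass\<close>. If a linear combination of the \<open>T\<^sub>k\<close> with a coefficient
\<open>c \<noteq> 0\<close> at \<open>k\<close> were in \<open>[I, B(H)]\<close>, then \<open>\<bar>c\<bar>/2 \<cdot> n (\<xi>\<^sub>a)\<^sub>n \<le> C n s\<^sub>n(Z)\<close> for infinitely
many of these \<open>n\<close>, whatever \<open>m\<close> is. This contradicts the assumption on \<open>\<xi>\<close>, applied to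
\<open>\<chi> = s(Z)\<close>. Hence the \<open>T\<^sub>k\<close> are linearly independent modulo \<open>[I, B(H)]\<close>.

The s-numbers of the elements of \<open>I\<close> are accessible because a proper ideal consists of compact
operators (\<open>proper_ideal_compact\<close>) and a compact operator has an orthonormal sequence of singular
vectors (\<open>singular_vector_exists\<close>, \<open>s_numbers_singular_system\<close>).\<close>

section \<open>Inner products and bounded operators\<close>

lemma cinner_add_right: "cinner x (y + z) = cinner x y + cinner x z"
  for x :: "'a::complex_inner"
  by (metis cinner_add_left cinner_commute complex_cnj_add)

lemma cinner_scaleC_right: "cinner x (a *\<^sub>C y) = cnj a * cinner x y"
  for x :: "'a::complex_inner"
  by (metis cinner_commute cinner_scaleC_left complex_cnj_mult)

lemma cinner_zero_left [simp]: "cinner 0 x = 0" for x :: "'a::complex_inner"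
  by (metis cinner_add_left add_cancel_right_left)

lemma cinner_zero_right [simp]: "cinner x 0 = 0" for x :: "'a::complex_inner"
  by (metis cinner_add_right add_cancel_right_left)

lemma cinner_minus_left: "cinner (- x) y = - cinner x y" for x :: "'a::complex_inner"
  using cinner_add_left[of x "- x" y] by (simp add: eq_neg_iff_add_eq_0 add.commute)

lemma cinner_minus_right: "cinner x (- y) = - cinner x y" for x :: "'a::complex_inner"
  using cinner_add_right[of x y "- y"] by (simp add: eq_neg_iff_add_eq_0 add.commute)

lemma cinner_diff_left: "cinner (x - y) z = cinner x z - cinner y z" for x :: "'a::complex_inner"
  using cinner_add_left[of x "- y" z] by (simp add: cinner_minus_left)

lemma cinner_diff_right: "cinner x (y - z) = cinner x y - cinner x z" for x :: "'a::complex_inner"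
  using cinner_add_right[of x y "- z"] by (simp add: cinner_minus_right)

lemma cinner_sum_left: "cinner (sum f A) y = (\<Sum>i\<in>A. cinner (f i) y)"
  for y :: "'a::complex_inner"
  by (induction A rule: infinite_finite_induct) (simp_all add: cinner_add_left)

lemma cinner_sum_right: "cinner x (sum f A) = (\<Sum>i\<in>A. cinner x (f i))"
  for x :: "'a::complex_inner"
  by (induction A rule: infinite_finite_induct) (simp_all add: cinner_add_right)

lemma cinner_eq_0_commute: "cinner x y = 0 \<longleftrightarrow> cinner y x = 0" for x :: "'a::complex_inner"
  by (metis cinner_commute complex_cnj_zero)

lemma cinner_self: "cinner x x = complex_of_real ((norm x)\<^sup>2)" for x :: "'a::complex_inner"
proof -
  have "Im (cinner x x) = 0"
    using cinner_commute[of x x] by (simp add: complex_eq_iff)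
  moreover have "0 \<le> Re (cinner x x)"
    using norm_ge_zero[of x] by (simp add: norm_eq_sqrt_cinner)
  ultimately show ?thesis
    by (simp add: complex_eq_iff norm_eq_sqrt_cinner)
qed

lemma pythagoras:
  fixes x y :: "'a::complex_inner"
  assumes "cinner x y = 0"
  shows "(norm (x + y))\<^sup>2 = (norm x)\<^sup>2 + (norm y)\<^sup>2"
proof -
  have "cinner y x = 0" using assms cinner_eq_0_commute by blast
  then have "cinner (x + y) (x + y) = cinner x x + cinner y y"
    using assms by (simp add: cinner_add_left cinner_add_right)
  then show ?thesis
    by (metis Re_complex_of_real cinner_self of_real_add)
qed

lemma norm_diff_squared:
  "(norm (x - y))\<^sup>2 = (norm x)\<^sup>2 - 2 * Re (cinner x y) + (norm y)\<^sup>2" for x :: "'a::complex_inner"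
proof -
  have "Re (cinner y x) = Re (cinner x y)"
    using cinner_commute[of x y] by simp
  then have "Re (cinner (x - y) (x - y)) = Re (cinner x x) - 2 * Re (cinner x y) + Re (cinner y y)"
    by (simp add: cinner_diff_left cinner_diff_right)
  then show ?thesis by (simp add: cinner_self flip: of_real_power)
qed

lemma cauchy_schwarz: "cmod (cinner x y) \<le> norm x * norm y" for x :: "'a::complex_inner"
proof (cases "y = 0")
  case False
  define c where "c = cinner x y / cinner y y"
  have ny: "cinner y y \<noteq> 0" using False by (simp add: cinner_self)
  have "cinner (c *\<^sub>C y) (x - c *\<^sub>C y) = 0"
  proof -
    have "cinner (x - c *\<^sub>C y) y = 0"
      using ny by (simp add: cinner_diff_left cinner_scaleC_left c_def)
    then have "cinner y (x - c *\<^sub>C y) = 0" using cinner_eq_0_commute by blast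
    then show ?thesis by (simp add: cinner_scaleC_left)
  qed
  from pythagoras[OF this] have "(norm (c *\<^sub>C y))\<^sup>2 \<le> (norm x)\<^sup>2"
    by simp
  then have "norm (c *\<^sub>C y) \<le> norm x" by (simp add: power2_le_iff_abs_le)
  moreover have "cmod (cinner y y) = norm y * norm y"
    by (simp only: cinner_self norm_of_real abs_power2) (simp add: power2_eq_square)
  ultimately show ?thesis using False
    by (simp add: norm_scaleC c_def norm_divide field_simps)
qed simp

lemma tendsto_scaleC: "(f \<longlongrightarrow> l) F \<Longrightarrow> ((\<lambda>i. c *\<^sub>C f i) \<longlongrightarrow> c *\<^sub>C l) F"
  for l :: "'a::complex_inner"
  by (rule bounded_linear.tendsto[OF bounded_linear_intro[of _ "cmod c"]])
    (simp_all add: scaleC_add_right scaleR_scaleC scaleC_scaleC norm_scaleC mult.commute)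

lemma tendsto_cinner_left:
  fixes y :: "'a::complex_inner"
  assumes "(f \<longlongrightarrow> l) F"
  shows "((\<lambda>i. cinner (f i) y) \<longlongrightarrow> cinner l y) F"
proof -
  have "bounded_linear (\<lambda>x. cinner x y)"
    by (rule bounded_linear_intro[of _ "norm y"])
      (auto simp: cinner_add_left scaleR_scaleC cinner_scaleC_left scaleR_conv_of_real cauchy_schwarz)
  from bounded_linear.tendsto[OF this assms] show ?thesis .
qed

lemma bop_add: "bop_apply A (x + y) = bop_apply A x + bop_apply A y"
  by (transfer) (auto dest: bounded_linear.linear linear_add)

lemma bop_scaleC: "bop_apply A (c *\<^sub>C x) = c *\<^sub>C bop_apply A x"
  by transfer auto

lemma bop_zero [simp]: "bop_apply A 0 = 0"
  by transfer (auto dest: bounded_linear.linear linear_0)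

lemma bop_diff: "bop_apply A (x - y) = bop_apply A x - bop_apply A y"
  by transfer (auto dest: bounded_linear.linear linear_diff)

lemma bop_sum: "bop_apply A (sum f S) = (\<Sum>i\<in>S. bop_apply A (f i))"
  by (induction S rule: infinite_finite_induct) (simp_all add: bop_add)

lemma bop_bounded: "\<exists>K\<ge>0. \<forall>x. norm (bop_apply A x) \<le> K * norm x"
  by transfer (metis bounded_linear.nonneg_bounded mult.commute)

lemma bop_tendsto: "(f \<longlongrightarrow> l) F \<Longrightarrow> ((\<lambda>i. bop_apply A (f i)) \<longlongrightarrow> bop_apply A l) F"
  by (rule bounded_linear.tendsto) (use bop_apply[of A] in auto)

lemmas bop_apply_simps [simp] = times_bop.rep_eq plus_bop.rep_eq minus_bop.rep_eq
  zero_bop.rep_eq uminus_bop.rep_eq scaleC_bop.rep_eq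

lemma bop_apply_sum: "bop_apply (sum A S) x = (\<Sum>i\<in>S. bop_apply (A i) x)"
  by (induction S rule: infinite_finite_induct) simp_all

lemma bop_exists:
  fixes f :: "'h::complex_inner \<Rightarrow> 'h"
  assumes "\<And>x y. f (x + y) = f x + f y" "\<And>c x. f (c *\<^sub>C x) = c *\<^sub>C f x"
    "\<And>x. norm (f x) \<le> K * norm x"
  shows "\<exists>A. \<forall>x. bop_apply A x = f x"
proof -
  have "bounded_linear f"
    by (rule bounded_linear_intro[of _ K]) (use assms in \<open>auto simp: scaleR_scaleC mult.commute\<close>)
  then have "\<forall>x. bop_apply (Bop f) x = f x"
    using assms by (simp add: Bop_inverse)
  then show ?thesis by blast
qed


section \<open>Orthonormal families\<close>

definition orthonormal :: "'i set \<Rightarrow> ('i \<Rightarrow> 'a::complex_inner) \<Rightarrow> bool" where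
  "orthonormal J e \<longleftrightarrow> (\<forall>i\<in>J. \<forall>j\<in>J. cinner (e i) (e j) = (if i = j then 1 else 0))"

definition proj :: "'i set \<Rightarrow> ('i \<Rightarrow> 'a::complex_inner) \<Rightarrow> 'a \<Rightarrow> 'a" where
  "proj J e x = (\<Sum>j\<in>J. cinner x (e j) *\<^sub>C e j)"

lemma orthonormal_subset: "orthonormal J e \<Longrightarrow> J' \<subseteq> J \<Longrightarrow> orthonormal J' e"
  unfolding orthonormal_def by blast

lemma orthonormal_norm: "orthonormal J e \<Longrightarrow> j \<in> J \<Longrightarrow> norm (e j) = 1"
  by (simp add: orthonormal_def norm_eq_sqrt_cinner)

lemma orthonormal_inj_on: "orthonormal J e \<Longrightarrow> inj_on e J"
  unfolding orthonormal_def inj_on_def by (metis one_neq_zero)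

lemma orthonormal_image: "orthonormal J e \<Longrightarrow> orthonormal (e ` J) (\<lambda>x. x)"
  using orthonormal_inj_on[of J e] unfolding orthonormal_def by (auto simp: inj_on_eq_iff)

lemma cinner_orthonormal_sum:
  assumes "orthonormal J e" "finite J" "i \<in> J"
  shows "cinner (\<Sum>j\<in>J. c j *\<^sub>C e j) (e i) = c i"
proof -
  have "cinner (\<Sum>j\<in>J. c j *\<^sub>C e j) (e i) = (\<Sum>j\<in>J. if i = j then c j else 0)"
    unfolding cinner_sum_left
    by (intro sum.cong) (use assms in \<open>auto simp: orthonormal_def cinner_scaleC_left\<close>)
  then show ?thesis using assms by simp
qed

lemma norm_orthonormal_sum:
  assumes "orthonormal J e" "finite J"
  shows "(norm (\<Sum>j\<in>J. c j *\<^sub>C e j))\<^sup>2 = (\<Sum>j\<in>J. (cmod (c j))\<^sup>2)"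
proof -
  have "cinner (\<Sum>j\<in>J. c j *\<^sub>C e j) (\<Sum>j\<in>J. c j *\<^sub>C e j) = (\<Sum>j\<in>J. cnj (c j) * c j)"
    by (subst cinner_sum_right) (simp add: cinner_scaleC_right cinner_orthonormal_sum[OF assms])
  also have "\<dots> = complex_of_real (\<Sum>j\<in>J. (cmod (c j))\<^sup>2)"
    unfolding of_real_sum by (intro sum.cong) (simp_all add: complex_norm_square mult.commute flip: of_real_power)
  finally show ?thesis unfolding cinner_self of_real_eq_iff .
qed

lemma cinner_residual:
  assumes "orthonormal J e" "finite J" "i \<in> J"
  shows "cinner (x - proj J e x) (e i) = 0"
  using cinner_orthonormal_sum[OF assms] by (simp add: proj_def cinner_diff_left)

lemma cinner_proj_eq_0:
  assumes "\<And>i. i \<in> J \<Longrightarrow> cinner v (e i) = 0"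
  shows "cinner v (proj J e x) = 0"
  using assms by (simp add: proj_def cinner_sum_right cinner_scaleC_right)

lemma bessel:
  assumes "orthonormal J e" "finite J"
  shows "(\<Sum>j\<in>J. (cmod (cinner x (e j)))\<^sup>2) + (norm (x - proj J e x))\<^sup>2 = (norm x)\<^sup>2"
proof -
  have "cinner (x - proj J e x) (proj J e x) = 0"
    by (rule cinner_proj_eq_0) (rule cinner_residual[OF assms])
  from pythagoras[OF this] norm_orthonormal_sum[OF assms, of "\<lambda>j. cinner x (e j)"]
  show ?thesis by (simp add: proj_def)
qed

lemma bessel_le:
  assumes "orthonormal J e" "finite J"
  shows "(\<Sum>j\<in>J. (cmod (cinner x (e j)))\<^sup>2) \<le> (norm x)\<^sup>2"
  using bessel[OF assms, of x] by (smt (verit) zero_le_power2)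

lemma norm_residual_le:
  assumes "orthonormal J e" "finite J"
  shows "norm (x - proj J e x) \<le> norm x"
proof -
  have "0 \<le> (\<Sum>j\<in>J. (cmod (cinner x (e j)))\<^sup>2)" by (simp add: sum_nonneg)
  then have "(norm (x - proj J e x))\<^sup>2 \<le> (norm x)\<^sup>2" using bessel[OF assms, of x] by linarith
  then show ?thesis by (simp add: power2_le_iff_abs_le)
qed

lemma norm_proj_le:
  assumes "orthonormal J e" "finite J"
  shows "norm (proj J e x) \<le> (\<Sum>j\<in>J. cmod (cinner x (e j)))"
  unfolding proj_def
  by (rule order_trans[OF norm_sum]) (simp add: norm_scaleC orthonormal_norm[OF assms(1)])

lemma proj_in_span: "proj J e x \<in> complex_vector.span (e ` J)"
  unfolding proj_def
  by (intro complex_vector.span_sum complex_vector.span_scale complex_vector.span_base) auto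

lemma proj_add: "proj J e (x + y) = proj J e x + proj J e y"
  by (simp add: proj_def cinner_add_left scaleC_add_left sum.distrib)

lemma proj_scaleC: "proj J e (c *\<^sub>C x) = c *\<^sub>C proj J e x"
  by (simp add: proj_def cinner_scaleC_left complex_vector.scale_sum_right scaleC_scaleC)

lemma orthogonal_span:
  fixes v :: "'a::complex_inner"
  assumes "x \<in> complex_vector.span S" "\<And>s. s \<in> S \<Longrightarrow> cinner v s = 0"
  shows "cinner v x = 0"
  using assms(1)
  by (induction rule: complex_vector.span_induct_alt)
    (simp_all add: cinner_add_right cinner_scaleC_right assms)

lemma proj_span:
  assumes "orthonormal J e" "finite J" "x \<in> complex_vector.span (e ` J)"
  shows "proj J e x = x"
proof -
  let ?r = "x - proj J e x"
  have "?r \<in> complex_vector.span (e ` J)"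
    using assms(3) proj_in_span by (rule complex_vector.span_diff)
  then have "cinner ?r ?r = 0"
    by (rule orthogonal_span) (use cinner_residual[OF assms(1,2)] in auto)
  then show ?thesis by (simp add: cinner_self)
qed


lemma orthonormal_independent:
  assumes "orthonormal B (\<lambda>x. x)"
  shows "\<not> complex_vector.dependent B"
  unfolding complex_vector.independent_explicit_module
proof (intro allI impI)
  fix t :: "'a set" and u :: "'a \<Rightarrow> complex" and v
  assume t: "finite t" "t \<subseteq> B" and "(\<Sum>v\<in>t. u v *\<^sub>C v) = 0" and v: "v \<in> t"
  then have "cinner (\<Sum>v\<in>t. u v *\<^sub>C v) v = 0" by simp
  then show "u v = 0"
    using cinner_orthonormal_sum[OF orthonormal_subset[OF assms t(2)] t(1) v, of u] by simp
qed

lemma norm_normalized: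
  assumes "r \<noteq> (0::'a::complex_inner)"
  shows "norm ((1 / complex_of_real (norm r)) *\<^sub>C r) = 1"
  using assms by (simp add: norm_scaleC norm_divide)

text \<open>The bound on the cardinality matters as much as the span: the traces below are estimated on
sets \<open>B'\<close> obtained in this way, and the estimate is proportional to their size.\<close>

lemma gram_schmidt:
  assumes "finite S" "finite B" "orthonormal B (\<lambda>x. x)"
  shows "\<exists>B'. finite B' \<and> B \<subseteq> B' \<and> orthonormal B' (\<lambda>x. x) \<and>
           card B' \<le> card B + card S \<and> S \<subseteq> complex_vector.span B'"
  using assms(1)
proof induction
  case empty
  then show ?case using assms by auto
next
  case (insert s S)
  then obtain B' where B': "finite B'" "B \<subseteq> B'" "orthonormal B' (\<lambda>x. x)"
      "card B' \<le> card B + card S" "S \<subseteq> complex_vector.span B'"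
    by blast
  show ?case
  proof (cases "s \<in> complex_vector.span B'")
    case True
    then show ?thesis using B' insert.hyps by (intro exI[of _ B']) auto
  next
    case False
    define r where "r = s - proj B' (\<lambda>x. x) s"
    define u where "u = (1 / complex_of_real (norm r)) *\<^sub>C r"
    have pr: "proj B' (\<lambda>x. x) s \<in> complex_vector.span B'"
      using proj_in_span[of B' "\<lambda>x. x" s] by simp
    have r0: "r \<noteq> 0" using False pr by (auto simp: r_def)
    have orth: "cinner u b = 0" "cinner b u = 0" if "b \<in> B'" for b
    proof -
      show "cinner u b = 0"
        using cinner_residual[OF B'(3,1) that, of s] by (simp add: u_def r_def cinner_scaleC_left)
      then show "cinner b u = 0" using cinner_eq_0_commute by blast
    qed
    have "cinner u u = 1" using norm_normalized[OF r0] by (simp add: cinner_self u_def)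
    then have u: "u \<notin> B'" "orthonormal (insert u B') (\<lambda>x. x)"
      using orth B'(3) by (auto simp: orthonormal_def)
    have "s = proj B' (\<lambda>x. x) s + complex_of_real (norm r) *\<^sub>C u"
      using r0 by (simp add: u_def r_def scaleC_scaleC scaleC_one)
    moreover have "\<dots> \<in> complex_vector.span (insert u B')"
      using pr complex_vector.span_mono[of B' "insert u B'"]
      by (intro complex_vector.span_add complex_vector.span_scale)
        (auto intro: complex_vector.span_base)
    ultimately have "insert s S \<subseteq> complex_vector.span (insert u B')"
      using B'(5) complex_vector.span_mono[of B' "insert u B'"] by auto
    then show ?thesis
      using B' u insert.hyps by (intro exI[of _ "insert u B'"]) auto
  qed
qed

lemma orthogonal_unit_vector:
  fixes S :: "'h::complex_inner set"
  assumes "\<not> (\<exists>B :: 'h set. finite B \<and> complex_vector.span B = UNIV)" "finite S"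
  shows "\<exists>v. norm v = 1 \<and> (\<forall>s\<in>S. cinner v s = 0)"
proof -
  have "orthonormal {} (\<lambda>x::'h. x)" by (simp add: orthonormal_def)
  then obtain B where B: "finite B" "orthonormal B (\<lambda>x. x)" "S \<subseteq> complex_vector.span B"
    using gram_schmidt[OF assms(2), of "{}"] by auto
  obtain x where x: "x \<notin> complex_vector.span B" using assms(1) B(1) by blast
  define r where "r = x - proj B (\<lambda>x. x) x"
  have r0: "r \<noteq> 0" using x proj_in_span[of B "\<lambda>x. x" x] by (auto simp: r_def)
  have "cinner r s = 0" if "s \<in> S" for s
    by (rule orthogonal_span[of _ B])
      (use that B(3) cinner_residual[OF B(2,1)] in \<open>auto simp: r_def\<close>)
  then show ?thesis
    using norm_normalized[OF r0]
    by (intro exI[of _ "(1 / complex_of_real (norm r)) *\<^sub>C r"]) (simp add: cinner_scaleC_left)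
qed

text \<open>Dependent choice for orthonormal sequences whose \<open>n\<close>-th vector satisfies a condition that refers
to the earlier ones. It produces orthonormal bases, the vectors on which a noncompact operator is
bounded below, and singular vectors.\<close>

lemma orthonormal_sequence_choice:
  fixes Q :: "nat \<Rightarrow> (nat \<Rightarrow> 'a::complex_inner) \<Rightarrow> 'a \<Rightarrow> bool"
  assumes step: "\<And>n e. orthonormal {..<n} e \<Longrightarrow> (\<And>j. j < n \<Longrightarrow> Q j e (e j)) \<Longrightarrow>
      \<exists>v. norm v = 1 \<and> (\<forall>j<n. cinner v (e j) = 0) \<and> Q n e v"
    and cong: "\<And>n e e' v. (\<And>j. j < n \<Longrightarrow> e j = e' j) \<Longrightarrow> Q n e v = Q n e' v"
  shows "\<exists>e. orthonormal UNIV e \<and> (\<forall>n. Q n e (e n))"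
proof -
  define R where "R = (\<lambda>e n v. norm v = 1 \<and> (\<forall>j<n. cinner v (e j) = 0) \<and> Q n e v)"
  have on: "orthonormal J e" if R: "\<And>j. j \<in> J \<Longrightarrow> R e j (e j)" for J e
    unfolding orthonormal_def
  proof (intro ballI)
    fix i j assume ij: "i \<in> J" "j \<in> J"
    have less: "cinner (e k) (e l) = 0" if "l < k" "k \<in> J" for k l
      using R[OF that(2)] that(1) by (simp add: R_def)
    have "cinner (e i) (e i) = 1"
      using R[OF ij(1)] by (simp add: R_def cinner_self)
    moreover have "cinner (e i) (e j) = 0" if "i \<noteq> j"
      using less[of i j] less[of j i] ij that cinner_eq_0_commute[of "e i" "e j"]
      by (cases i j rule: linorder_cases) auto
    ultimately show "cinner (e i) (e j) = (if i = j then 1 else 0)"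
      by (cases "i = j") simp_all
  qed
  have "\<exists>e. \<forall>n. R e n (e n)"
  proof (rule dependent_wellorder_choice)
    fix r n and f g :: "nat \<Rightarrow> 'a"
    assume "\<And>j. j < n \<Longrightarrow> f j = g j"
    then show "R f n r = R g n r" using cong[of n f g r] by (simp add: R_def)
  next
    fix n e assume e: "\<And>j. j < n \<Longrightarrow> R e j (e j)"
    then have "orthonormal {..<n} e" by (intro on) simp
    moreover have "Q j e (e j)" if "j < n" for j using e[OF that] by (simp add: R_def)
    ultimately show "\<exists>v. R e n v" using step[of n e] by (simp add: R_def)
  qed
  then obtain e where "\<And>n. R e n (e n)" by blast
  then show ?thesis using on[of UNIV e] by (intro exI[of _ e]) (simp add: R_def)
qed

text \<open>The orthogonal projection onto the span of \<open>F\<close> cannot be injective on a space of larger dimension.\<close>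

lemma exists_orthogonal_in_span:
  fixes e :: "'i \<Rightarrow> 'a::complex_inner"
  assumes e: "orthonormal J e" and J: "finite J" and F: "finite F" and less: "card F < card J"
  shows "\<exists>v\<in>complex_vector.span (e ` J). v \<noteq> 0 \<and> (\<forall>w\<in>F. cinner v w = 0)"
proof (rule ccontr)
  assume contra: "\<not> ?thesis"
  have "orthonormal {} (\<lambda>x::'a. x)" by (simp add: orthonormal_def)
  then obtain B where B: "finite B" "orthonormal B (\<lambda>x. x)" "card B \<le> card F"
      "F \<subseteq> complex_vector.span B"
    using gram_schmidt[OF F, of "{}"] by auto
  define P where "P = proj B (\<lambda>x. x)"
  interpret P: Vector_Spaces.linear scaleC scaleC P
    by unfold_locales (auto simp: P_def proj_add proj_scaleC)
  have "v = 0" if v: "v \<in> complex_vector.span (e ` J)" and Pv: "P v = 0" for v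
  proof -
    have "cinner v b = 0" if "b \<in> B" for b
      using cinner_residual[OF B(2,1) that, of v] Pv by (simp add: P_def)
    then have "\<forall>w\<in>F. cinner v w = 0" using B(4) by (auto intro: orthogonal_span)
    then show ?thesis using contra v by blast
  qed
  then have inj: "inj_on P (complex_vector.span (e ` J))"
    by (simp add: P.inj_on_iff_eq_0)
  have "\<not> complex_vector.dependent (e ` J)"
    using orthonormal_independent[OF orthonormal_image[OF e]] .
  then have "\<not> complex_vector.dependent (P ` (e ` J))"
    using inj by (rule P.independent_injective_image)
  moreover have "P ` (e ` J) \<subseteq> complex_vector.span B"
    using proj_in_span[of B "\<lambda>x. x"] by (auto simp: P_def)
  ultimately have "card (P ` (e ` J)) \<le> card B"
    using complex_vector.independent_span_bound[OF B(1)] by blast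
  moreover have "card (P ` (e ` J)) = card (e ` J)"
    by (rule card_image, rule inj_on_subset[OF inj complex_vector.span_superset])
  moreover have "card (e ` J) = card J" by (rule card_image[OF orthonormal_inj_on[OF e]])
  ultimately show False using B(3) less by simp
qed

section \<open>Orthonormal bases, adjoints and diagonal maps between orthonormal sequences\<close>

lemma summable_orthonormal:
  fixes e :: "nat \<Rightarrow> 'h::chilbert_space"
  assumes e: "orthonormal UNIV e" and bound: "\<And>n. (\<Sum>i<n. (cmod (c i))\<^sup>2) \<le> K"
  shows "summable (\<lambda>i. c i *\<^sub>C e i)"
proof -
  have "summable (\<lambda>i. (cmod (c i))\<^sup>2)"
    by (rule summableI_nonneg_bounded[of _ K]) (use bound in auto)
  then have C: "Cauchy (\<lambda>n. \<Sum>i<n. (cmod (c i))\<^sup>2)"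
    by (simp add: summable_iff_convergent Cauchy_convergent_iff)
  have "Cauchy (\<lambda>n. \<Sum>i<n. c i *\<^sub>C e i)"
  proof (rule CauchyI')
    fix r :: real assume r: "r > 0"
    then obtain M where M: "\<And>m n. m \<ge> M \<Longrightarrow> n \<ge> M \<Longrightarrow>
        dist (\<Sum>i<m. (cmod (c i))\<^sup>2) (\<Sum>i<n. (cmod (c i))\<^sup>2) < r\<^sup>2"
      using C[unfolded Cauchy_def, rule_format, of "r\<^sup>2"] by auto
    have "norm ((\<Sum>i<m. c i *\<^sub>C e i) - (\<Sum>i<n. c i *\<^sub>C e i)) < r" if "m \<ge> M" "m < n" for m n
    proof -
      have split: "sum f {..<n} = sum f {..<m} + sum f {m..<n}" for f :: "nat \<Rightarrow> 'z::comm_monoid_add"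
        using that(2) sum.atLeastLessThan_concat[of 0 m n f] by (simp add: atLeast0LessThan)
      have "(norm ((\<Sum>i<m. c i *\<^sub>C e i) - (\<Sum>i<n. c i *\<^sub>C e i)))\<^sup>2 =
          (\<Sum>i=m..<n. (cmod (c i))\<^sup>2)"
        using norm_orthonormal_sum[OF orthonormal_subset[OF e subset_UNIV], of "{m..<n}" c]
        by (simp add: split norm_minus_commute)
      also have "\<dots> \<le> dist (\<Sum>i<m. (cmod (c i))\<^sup>2) (\<Sum>i<n. (cmod (c i))\<^sup>2)"
        by (simp add: split dist_real_def)
      also have "\<dots> < r\<^sup>2" using M that by auto
      finally show ?thesis using r by (simp add: power_less_imp_less_base)
    qed
    then show "\<exists>M. \<forall>m\<ge>M. \<forall>n>m. dist (\<Sum>i<m. c i *\<^sub>C e i) (\<Sum>i<n. c i *\<^sub>C e i) < r"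
      unfolding dist_norm by blast
  qed
  then show ?thesis by (simp add: summable_iff_convergent Cauchy_convergent_iff)
qed

lemma cinner_suminf_orthonormal:
  fixes e :: "nat \<Rightarrow> 'h::chilbert_space"
  assumes e: "orthonormal UNIV e" and "summable (\<lambda>i. c i *\<^sub>C e i)"
  shows "cinner (\<Sum>i. c i *\<^sub>C e i) (e k) = c k"
proof -
  have "(\<lambda>n. \<Sum>i<n. c i *\<^sub>C e i) \<longlonglongrightarrow> (\<Sum>i. c i *\<^sub>C e i)"
    using assms(2) by (rule summable_LIMSEQ)
  then have "(\<lambda>n. cinner (\<Sum>i<n. c i *\<^sub>C e i) (e k)) \<longlonglongrightarrow> cinner (\<Sum>i. c i *\<^sub>C e i) (e k)"
    by (rule tendsto_cinner_left)
  moreover have "(\<lambda>n. cinner (\<Sum>i<n. c i *\<^sub>C e i) (e k)) \<longlonglongrightarrow> c k"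
  proof (rule tendsto_eventually)
    show "\<forall>\<^sub>F n in sequentially. cinner (\<Sum>i<n. c i *\<^sub>C e i) (e k) = c k"
      using eventually_gt_at_top[of k]
      by eventually_elim (simp add: cinner_orthonormal_sum[OF orthonormal_subset[OF e subset_UNIV]])
  qed
  ultimately show ?thesis by (rule LIMSEQ_unique)
qed

lemma bessel_lessThan:
  "orthonormal UNIV e \<Longrightarrow> (\<Sum>i<n. (cmod (cinner x (e i)))\<^sup>2) \<le> (norm x)\<^sup>2"
  for e :: "nat \<Rightarrow> 'h::complex_inner"
  using bessel_le[OF orthonormal_subset[OF _ subset_UNIV]] by blast

lemma cinner_orthonormal_tendsto_0:
  fixes e :: "nat \<Rightarrow> 'h::complex_inner"
  assumes "orthonormal UNIV e"
  shows "(\<lambda>i. cinner x (e i)) \<longlonglongrightarrow> 0"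
proof -
  have "summable (\<lambda>i. (cmod (cinner x (e i)))\<^sup>2)"
    by (rule summableI_nonneg_bounded[of _ "(norm x)\<^sup>2"]) (use bessel_lessThan[OF assms] in auto)
  then have "(\<lambda>i. sqrt ((cmod (cinner x (e i)))\<^sup>2)) \<longlonglongrightarrow> sqrt 0"
    by (intro tendsto_real_sqrt summable_LIMSEQ_zero)
  then show ?thesis by (simp add: tendsto_norm_zero_iff)
qed

definition orthonormal_basis :: "(nat \<Rightarrow> 'h::complex_inner) \<Rightarrow> bool" where
  "orthonormal_basis b \<longleftrightarrow> orthonormal UNIV b \<and> (\<forall>x. (\<forall>i. cinner x (b i) = 0) \<longrightarrow> x = 0)"

lemma orthonormal_basis_expansion:
  fixes b :: "nat \<Rightarrow> 'h::chilbert_space"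
  assumes b: "orthonormal_basis b"
  shows "(\<lambda>n. \<Sum>i<n. cinner x (b i) *\<^sub>C b i) \<longlonglongrightarrow> x"
proof -
  have on: "orthonormal UNIV b" using b by (simp add: orthonormal_basis_def)
  have sm: "summable (\<lambda>i. cinner x (b i) *\<^sub>C b i)"
    using on by (rule summable_orthonormal) (rule bessel_lessThan[OF on])
  have "cinner (x - (\<Sum>i. cinner x (b i) *\<^sub>C b i)) (b k) = 0" for k
    by (simp add: cinner_diff_left cinner_suminf_orthonormal[OF on sm])
  then have "x - (\<Sum>i. cinner x (b i) *\<^sub>C b i) = 0"
    using b unfolding orthonormal_basis_def by blast
  then show ?thesis using summable_LIMSEQ[OF sm] by simp
qed

lemma bop_eqI:
  fixes A B :: "'h::complex_inner bop"
  assumes "\<And>x. bop_apply A x = bop_apply B x"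
  shows "A = B"
  using assms bop_apply_inject by (metis ext)

lemma bop_eq_on_basis:
  fixes A B :: "'h::chilbert_space bop"
  assumes b: "orthonormal_basis b" and eq: "\<And>i. bop_apply A (b i) = bop_apply B (b i)"
  shows "A = B"
proof (rule bop_eqI)
  fix x
  let ?s = "\<lambda>n. \<Sum>i<n. cinner x (b i) *\<^sub>C b i"
  have "(\<lambda>n. bop_apply A (?s n)) \<longlonglongrightarrow> bop_apply A x" "(\<lambda>n. bop_apply B (?s n)) \<longlonglongrightarrow> bop_apply B x"
    using orthonormal_basis_expansion[OF b] by (auto intro: bop_tendsto)
  moreover have "bop_apply A (?s n) = bop_apply B (?s n)" for n
    by (simp add: bop_sum bop_scaleC eq)
  ultimately show "bop_apply A x = bop_apply B x" by (simp add: LIMSEQ_unique)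
qed

text \<open>This is the Gram-Schmidt process along a dense sequence \<open>d\<close>, with \<open>d n\<close> in the span of the first
\<open>n + 1\<close> basis vectors. If \<open>d n\<close> adds nothing new, any unit vector orthogonal to the earlier ones
is inserted, which keeps the sequence infinite. A vector orthogonal to all basis vectors is
orthogonal to a dense set.\<close>

lemma exists_orthonormal_basis:
  assumes sep: "separable_space (euclidean :: 'h::complex_inner topology)"
    and inf: "\<not> (\<exists>B :: 'h set. finite B \<and> complex_vector.span B = UNIV)"
  shows "\<exists>b :: nat \<Rightarrow> 'h. orthonormal_basis b"
proof -
  obtain D :: "'h set" where D: "countable D" "closure D = UNIV"
    using sep unfolding separable_space_def by auto
  define d where "d = from_nat_into D"
  have D_ne: "D \<noteq> {}" using D(2) by auto
  have rd: "range d = D" using D(1) D_ne by (simp add: d_def range_from_nat_into)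
  have "\<exists>b. orthonormal UNIV b \<and> (\<forall>n. d n \<in> complex_vector.span (insert (b n) (b ` {..<n})))"
  proof (rule orthonormal_sequence_choice)
    fix n and b :: "nat \<Rightarrow> 'h" assume on: "orthonormal {..<n} b"
    show "\<exists>v. norm v = 1 \<and> (\<forall>j<n. cinner v (b j) = 0) \<and>
        d n \<in> complex_vector.span (insert v (b ` {..<n}))"
    proof (cases "d n \<in> complex_vector.span (b ` {..<n})")
      case True
      obtain v where "norm v = 1" "\<forall>s\<in>b ` {..<n}. cinner v s = 0"
        using orthogonal_unit_vector[OF inf, of "b ` {..<n}"] by auto
      then show ?thesis
        using True complex_vector.span_mono[of "b ` {..<n}" "insert v (b ` {..<n})"]
        by (intro exI[of _ v]) auto
    next
      case False
      let ?p = "proj {..<n} b (d n)"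
      define r where "r = d n - ?p"
      have r0: "r \<noteq> 0" using False proj_in_span[of "{..<n}" b "d n"] by (auto simp: r_def)
      define v where "v = (1 / complex_of_real (norm r)) *\<^sub>C r"
      have "cinner v (b j) = 0" if "j < n" for j
        using cinner_residual[OF on, of j "d n"] that by (simp add: v_def r_def cinner_scaleC_left)
      moreover have "d n \<in> complex_vector.span (insert v (b ` {..<n}))"
      proof -
        have "d n = ?p + complex_of_real (norm r) *\<^sub>C v"
          using r0 by (simp add: v_def r_def scaleC_scaleC scaleC_one)
        moreover have "?p \<in> complex_vector.span (insert v (b ` {..<n}))"
          using proj_in_span complex_vector.span_mono[OF subset_insertI] by blast
        moreover have "complex_of_real (norm r) *\<^sub>C v \<in> complex_vector.span (insert v (b ` {..<n}))"
          by (intro complex_vector.span_scale complex_vector.span_base) simp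
        ultimately show ?thesis
          using complex_vector.span_add by metis
      qed
      ultimately show ?thesis
        using norm_normalized[OF r0] by (intro exI[of _ v]) (simp add: v_def)
    qed
  next
    fix n and b b' :: "nat \<Rightarrow> 'h" and v
    assume "\<And>j. j < n \<Longrightarrow> b j = b' j"
    then have "b ` {..<n} = b' ` {..<n}" by auto
    then show "(d n \<in> complex_vector.span (insert v (b ` {..<n}))) =
        (d n \<in> complex_vector.span (insert v (b' ` {..<n})))" by simp
  qed
  then obtain b where on: "orthonormal UNIV b"
    and b: "\<And>n. d n \<in> complex_vector.span (insert (b n) (b ` {..<n}))" by blast
  have "x = 0" if x: "\<forall>i. cinner x (b i) = 0" for x
  proof -
    have "cinner y x = 0" if y: "y \<in> D" for y
    proof -
      obtain n where "y = d n" using y rd by blast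
      then have "y \<in> complex_vector.span (insert (b n) (b ` {..<n}))"
        using b[of n] by simp
      then have "cinner x y = 0" by (rule orthogonal_span) (use x in auto)
      then show ?thesis using cinner_eq_0_commute by blast
    qed
    moreover obtain y where y: "\<And>n. y n \<in> D" "y \<longlonglongrightarrow> x"
      using D(2) closure_sequential[of x D] by auto
    moreover have "(\<lambda>n. cinner (y n) x) \<longlonglongrightarrow> cinner x x" using y(2) by (rule tendsto_cinner_left)
    ultimately have "cinner x x = 0" by (simp add: LIMSEQ_const_iff)
    then show "x = 0" by (simp add: cinner_self)
  qed
  with on show ?thesis by (auto simp: orthonormal_basis_def)
qed

lemma cinner_ext:
  fixes y z :: "'h::complex_inner"
  assumes "\<And>x. cinner x y = cinner x z"
  shows "y = z"
proof -
  have "cinner (y - z) (y - z) = 0" using assms by (simp add: cinner_diff_right)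
  then show ?thesis by (simp add: cinner_self)
qed

text \<open>The coordinates of the image of \<open>y\<close> under the adjoint have to be \<open>c\<^sub>i = \<langle>y, X b\<^sub>i\<rangle>\<close>. They are
square summable: for a finite sum \<open>w = \<Sum> c\<^sub>i b\<^sub>i\<close> one has
\<open>\<parallel>w\<parallel>\<^sup>2 = \<langle>y, X w\<rangle> \<le> \<parallel>y\<parallel> K \<parallel>w\<parallel>\<close>.\<close>

lemma adjoint_exists:
  fixes X :: "'h::chilbert_space bop" and b :: "nat \<Rightarrow> 'h"
  assumes b: "orthonormal_basis b"
  shows "\<exists>Y. \<forall>x y. cinner (bop_apply X x) y = cinner x (bop_apply Y y)"
proof -
  have on: "orthonormal UNIV b" using b by (simp add: orthonormal_basis_def)
  obtain K where K: "K \<ge> 0" "\<And>x. norm (bop_apply X x) \<le> K * norm x"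
    using bop_bounded[of X] by blast
  have "\<exists>z. \<forall>x. cinner (bop_apply X x) y = cinner x z" for y
  proof -
    define c where "c = (\<lambda>i. cinner y (bop_apply X (b i)))"
    have "(\<Sum>i<n. (cmod (c i))\<^sup>2) \<le> (K * norm y)\<^sup>2" for n
    proof -
      define w where "w = (\<Sum>i<n. c i *\<^sub>C b i)"
      define t where "t = norm w"
      have t2: "t\<^sup>2 = (\<Sum>i<n. (cmod (c i))\<^sup>2)"
        unfolding t_def w_def by (rule norm_orthonormal_sum[OF orthonormal_subset[OF on]]) auto
      have "cinner y (bop_apply X w) = (\<Sum>i<n. cnj (c i) * c i)"
        by (simp add: w_def bop_sum bop_scaleC cinner_sum_right cinner_scaleC_right c_def)
      also have "\<dots> = complex_of_real (t\<^sup>2)"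
        unfolding t2 of_real_sum
        by (intro sum.cong) (simp_all add: complex_norm_square mult.commute flip: of_real_power)
      finally have "t\<^sup>2 = cmod (cinner y (bop_apply X w))" by (simp flip: of_real_power)
      also have "\<dots> \<le> norm y * (K * t)"
        unfolding t_def
        by (rule order_trans[OF cauchy_schwarz]) (intro mult_left_mono K norm_ge_zero)
      finally have "t * t \<le> (K * norm y) * t" by (simp add: power2_eq_square mult_ac)
      then have "t \<le> K * norm y"
        using K(1) by (cases "t = 0") (auto simp: t_def)
      then show ?thesis unfolding t2[symmetric] by (intro power_mono) (auto simp: t_def)
    qed
    then have sm: "summable (\<lambda>i. c i *\<^sub>C b i)" by (rule summable_orthonormal[OF on])
    define z where "z = (\<Sum>i. c i *\<^sub>C b i)"
    have z: "cinner z (b k) = c k" for k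
      unfolding z_def by (rule cinner_suminf_orthonormal[OF on sm])
    have "cinner (bop_apply X x) y = cinner x z" for x
    proof -
      let ?s = "\<lambda>n. \<Sum>i<n. cinner x (b i) *\<^sub>C b i"
      have "(\<lambda>n. cinner (bop_apply X (?s n)) y) \<longlonglongrightarrow> cinner (bop_apply X x) y"
        "(\<lambda>n. cinner (?s n) z) \<longlonglongrightarrow> cinner x z"
        using orthonormal_basis_expansion[OF b] by (auto intro!: tendsto_cinner_left bop_tendsto)
      moreover have "cinner (bop_apply X (?s n)) y = cinner (?s n) z" for n
      proof -
        have "cinner (bop_apply X (b i)) y = cinner (b i) z" for i
          using z[of i] cinner_commute by (metis c_def)
        then show ?thesis by (simp add: bop_sum bop_scaleC cinner_sum_left cinner_scaleC_left)
      qed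
      ultimately show ?thesis by (simp add: LIMSEQ_unique)
    qed
    then show ?thesis by blast
  qed
  then obtain g where g: "\<And>x y. cinner (bop_apply X x) y = cinner x (g y)" by metis
  have "norm (g y) \<le> K * norm y" for y
  proof -
    have "norm (g y) * norm (g y) = cmod (cinner (g y) (g y))"
      by (simp add: cinner_self power2_eq_square norm_mult)
    also have "\<dots> = cmod (cinner (bop_apply X (g y)) y)" by (simp add: g)
    also have "\<dots> \<le> (K * norm (g y)) * norm y"
      by (rule order_trans[OF cauchy_schwarz]) (intro mult_right_mono K norm_ge_zero)
    finally have "norm (g y) * norm (g y) \<le> (K * norm y) * norm (g y)" by (simp add: mult_ac)
    then show ?thesis
      using K(1) by (cases "g y = 0") auto
  qed
  moreover have "g (x + y) = g x + g y" for x y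
    by (rule cinner_ext) (simp add: cinner_add_right flip: g)
  moreover have "g (c *\<^sub>C x) = c *\<^sub>C g x" for c x
    by (rule cinner_ext) (simp add: cinner_scaleC_right flip: g)
  ultimately have "\<exists>Y. \<forall>x. bop_apply Y x = g x" by (intro bop_exists[of g K])
  then obtain Y where "\<And>x. bop_apply Y x = g x" by blast
  then show ?thesis using g by metis
qed

lemma cinner_adjoint_op:
  fixes X :: "'h::chilbert_space bop" and b :: "nat \<Rightarrow> 'h"
  assumes b: "orthonormal_basis b"
  shows "cinner (bop_apply X x) y = cinner x (bop_apply (adjoint_op X) y)"
proof -
  obtain Y where Y: "\<forall>x y. cinner (bop_apply X x) y = cinner x (bop_apply Y y)"
    using adjoint_exists[OF b] by blast
  have "adjoint_op X = Y"
    unfolding adjoint_op_def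
  proof (rule the_equality)
    fix Z assume "\<forall>x y. cinner (bop_apply X x) y = cinner x (bop_apply Z y)"
    then show "Z = Y" using Y by (intro bop_eqI cinner_ext) metis
  qed (rule Y)
  then show ?thesis using Y by simp
qed

text \<open>The operator is \<open>x \<mapsto> \<Sum> c\<^sub>i \<langle>x, e\<^sub>i\<rangle> f\<^sub>i\<close>. It covers isometries, their adjoints and diagonal
operators, which are the operators that elements of an ideal get multiplied by below.\<close>

lemma diagonal_map_exists:
  fixes e f :: "nat \<Rightarrow> 'h::chilbert_space"
  assumes e: "orthonormal UNIV e" and f: "orthonormal UNIV f" and c: "\<And>i. cmod (c i) \<le> M"
  shows "\<exists>A. (\<forall>x i. cinner (bop_apply A x) (f i) = c i * cinner x (e i)) \<and>
    (\<forall>i. bop_apply A (e i) = c i *\<^sub>C f i) \<and> (\<forall>x. norm (bop_apply A x) \<le> M * norm x) \<and>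
    (\<forall>x. (\<forall>i. cinner x (e i) = 0) \<longrightarrow> bop_apply A x = 0)"
proof -
  have M: "M \<ge> 0" using c[of 0] norm_ge_zero order_trans by blast
  have bnd: "(\<Sum>i<n. (cmod (c i * cinner x (e i)))\<^sup>2) \<le> (M * norm x)\<^sup>2" for x n
  proof -
    have "(\<Sum>i<n. (cmod (c i * cinner x (e i)))\<^sup>2) \<le> (\<Sum>i<n. M\<^sup>2 * (cmod (cinner x (e i)))\<^sup>2)"
      by (intro sum_mono) (simp add: norm_mult power_mult_distrib mult_right_mono power_mono c)
    also have "\<dots> \<le> M\<^sup>2 * (norm x)\<^sup>2"
      unfolding sum_distrib_left[symmetric] using bessel_lessThan[OF e] by (intro mult_left_mono) auto
    finally show ?thesis by (simp add: power_mult_distrib)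
  qed
  have sm: "summable (\<lambda>i. (c i * cinner x (e i)) *\<^sub>C f i)" for x
    using f bnd by (rule summable_orthonormal)
  define g where "g = (\<lambda>x. \<Sum>i. (c i * cinner x (e i)) *\<^sub>C f i)"
  have lim: "(\<lambda>n. \<Sum>i<n. (c i * cinner x (e i)) *\<^sub>C f i) \<longlonglongrightarrow> g x" for x
    unfolding g_def using sm by (rule summable_LIMSEQ)
  have coeff: "cinner (g x) (f i) = c i * cinner x (e i)" for x i
    unfolding g_def by (rule cinner_suminf_orthonormal[OF f sm])
  have norm: "norm (g x) \<le> M * norm x" for x
  proof (rule LIMSEQ_le_const2)
    show "(\<lambda>n. norm (\<Sum>i<n. (c i * cinner x (e i)) *\<^sub>C f i)) \<longlonglongrightarrow> norm (g x)"
      using lim by (rule tendsto_norm)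
    have "(norm (\<Sum>i<n. (c i * cinner x (e i)) *\<^sub>C f i))\<^sup>2 \<le> (M * norm x)\<^sup>2" for n
      using norm_orthonormal_sum[OF orthonormal_subset[OF f subset_UNIV], of "{..<n}"
          "\<lambda>i. c i * cinner x (e i)"] bnd[of x n] by simp
    then have "norm (\<Sum>i<n. (c i * cinner x (e i)) *\<^sub>C f i) \<le> M * norm x" for n
      by (rule power2_le_imp_le) (simp add: M)
    then show "\<exists>N. \<forall>n\<ge>N. norm (\<Sum>i<n. (c i * cinner x (e i)) *\<^sub>C f i) \<le> M * norm x"
      by blast
  qed
  have add: "g (x + y) = g x + g y" for x y
    unfolding g_def
    by (subst suminf_add[OF sm sm])
      (simp add: cinner_add_left distrib_left scaleC_add_left)
  have scale: "g (d *\<^sub>C x) = d *\<^sub>C g x" for d x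
  proof (rule LIMSEQ_unique[OF lim])
    from tendsto_scaleC[OF lim[of x], of d]
    show "(\<lambda>n. \<Sum>i<n. (c i * cinner (d *\<^sub>C x) (e i)) *\<^sub>C f i) \<longlonglongrightarrow> d *\<^sub>C g x"
      by (simp add: complex_vector.scale_sum_right scaleC_scaleC cinner_scaleC_left mult_ac)
  qed
  have on_e: "g (e i) = c i *\<^sub>C f i" for i
  proof -
    have "g (e i) = (\<Sum>j\<in>{i}. (c j * cinner (e i) (e j)) *\<^sub>C f j)"
      unfolding g_def by (rule suminf_finite) (use e in \<open>auto simp: orthonormal_def\<close>)
    also have "\<dots> = c i *\<^sub>C f i" using e by (simp add: orthonormal_def)
    finally show ?thesis .
  qed
  obtain A where A: "\<And>x. bop_apply A x = g x"
    using bop_exists[of g, OF add scale norm] by blast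
  show ?thesis
    by (rule exI[of _ A]) (auto simp: A coeff on_e norm, simp add: g_def)
qed

section \<open>Compactness and singular systems\<close>

text \<open>In a Hilbert space this is equivalent to compactness of the image of the unit ball. It is the
form in which compactness is used throughout: off finitely many directions the operator is small.\<close>

definition compact_bop :: "'h::complex_inner bop \<Rightarrow> bool" where
  "compact_bop X \<longleftrightarrow> (\<forall>\<delta>>0. \<exists>S. finite S \<and>
     (\<forall>v. (\<forall>s\<in>S. cinner v s = 0) \<longrightarrow> norm (bop_apply X v) \<le> \<delta> * norm v))"

lemma compact_bop_orthonormal:
  assumes "compact_bop X" "\<delta> > 0"
  shows "\<exists>B. finite B \<and> orthonormal B (\<lambda>x. x) \<and>
    (\<forall>v. (\<forall>s\<in>B. cinner v s = 0) \<longrightarrow> norm (bop_apply X v) \<le> \<delta> * norm v)"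
proof -
  obtain S where S: "finite S"
    "\<And>v. (\<forall>s\<in>S. cinner v s = 0) \<Longrightarrow> norm (bop_apply X v) \<le> \<delta> * norm v"
    using assms unfolding compact_bop_def by blast
  have "orthonormal {} (\<lambda>x::'a. x)" by (simp add: orthonormal_def)
  then obtain B where B: "finite B" "orthonormal B (\<lambda>x. x)" "S \<subseteq> complex_vector.span B"
    using gram_schmidt[OF S(1), of "{}"] by auto
  have "norm (bop_apply X v) \<le> \<delta> * norm v" if "\<forall>s\<in>B. cinner v s = 0" for v
    using that B(3) by (intro S(2)) (auto intro: orthogonal_span)
  then show ?thesis using B by blast
qed

lemma convergent_subsequence_finite:
  fixes c :: "'b \<Rightarrow> nat \<Rightarrow> complex"
  assumes "finite B" "\<And>b k. b \<in> B \<Longrightarrow> cmod (c b k) \<le> M b"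
  shows "\<exists>r. strict_mono (r :: nat \<Rightarrow> nat) \<and> (\<forall>b\<in>B. \<exists>l. (\<lambda>k. c b (r k)) \<longlonglongrightarrow> l)"
  using assms
proof (induction rule: finite_induct)
  case empty
  show ?case by (intro exI[of _ "\<lambda>k. k"]) (simp add: strict_mono_def)
next
  case (insert a B)
  then obtain r where r: "strict_mono r" "\<And>b. b \<in> B \<Longrightarrow> \<exists>l. (\<lambda>k. c b (r k)) \<longlonglongrightarrow> l" by blast
  have "bounded (range (\<lambda>k. c a (r k)))"
    using insert.prems by (auto simp: bounded_iff)
  then obtain l q where q: "strict_mono q" "((\<lambda>k. c a (r k)) \<circ> q) \<longlonglongrightarrow> l"
    using bounded_imp_convergent_subsequence by blast
  have "\<exists>l. (\<lambda>k. c b (r (q k))) \<longlonglongrightarrow> l" if b: "b \<in> insert a B" for b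
  proof (cases "b = a")
    case True
    then show ?thesis using q(2) by (auto simp: o_def)
  next
    case False
    then obtain l' where "(\<lambda>k. c b (r k)) \<longlonglongrightarrow> l'" using b r(2) by blast
    from LIMSEQ_subseq_LIMSEQ[OF this q(1)] show ?thesis by (auto simp: o_def)
  qed
  then show ?case
    using r(1) q(1) by (intro exI[of _ "r \<circ> q"]) (auto simp: strict_mono_def)
qed

lemma Cauchy_if_dist_le:
  fixes x :: "nat \<Rightarrow> 'a::metric_space"
  assumes "\<theta> \<longlonglongrightarrow> (0::real)" "\<And>m n. dist (x m) (x n) \<le> \<theta> m + \<theta> n"
  shows "Cauchy x"
proof (rule metric_CauchyI)
  fix e :: real assume "e > 0"
  then have "\<forall>\<^sub>F n in sequentially. \<theta> n < e / 2"
    using assms(1) by (intro order_tendstoD) auto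
  then obtain N where N: "\<And>n. n \<ge> N \<Longrightarrow> \<theta> n < e / 2" by (auto simp: eventually_sequentially)
  have "dist (x m) (x n) < e" if "m \<ge> N" "n \<ge> N" for m n
    using assms(2)[of m n] N[OF that(1)] N[OF that(2)] by linarith
  then show "\<exists>M. \<forall>m\<ge>M. \<forall>n\<ge>M. dist (x m) (x n) < e" by blast
qed

text \<open>The value \<open>s (Suc n)\<close> belongs to the vector \<open>e n\<close>, since sequences of s-numbers start at index
\<open>1\<close>. The last condition makes \<open>s (Suc n)\<close> the norm of \<open>X\<close> on the orthogonal complement of the
first \<open>n\<close> vectors; it encodes both the decreasing order and the error of truncating the singular
value decomposition.\<close>

definition singular_system :: "'h::chilbert_space bop \<Rightarrow> (nat \<Rightarrow> real) \<Rightarrow> (nat \<Rightarrow> 'h) \<Rightarrow> bool" where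
  "singular_system X s e \<longleftrightarrow> orthonormal UNIV e \<and> s 0 = 0 \<and>
     (\<forall>n. 0 \<le> s (Suc n) \<and>
       bop_apply (adjoint_op X * X) (e n) = complex_of_real ((s (Suc n))\<^sup>2) *\<^sub>C e n \<and>
       (\<forall>v. (\<forall>j<n. cinner v (e j) = 0) \<longrightarrow> norm (bop_apply X v) \<le> s (Suc n) * norm v))"

context
  fixes X :: "'h::chilbert_space bop" and s e
  assumes system: "singular_system X s e"
begin

lemma singular_system_orthonormal: "orthonormal UNIV e"
  using system by (simp add: singular_system_def)

lemma singular_system_nonneg: "0 \<le> s n"
  using system by (cases n) (simp_all add: singular_system_def)

lemma singular_system_eigenvector:
  "bop_apply (adjoint_op X * X) (e n) = complex_of_real ((s (Suc n))\<^sup>2) *\<^sub>C e n"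
  using system by (simp add: singular_system_def)

lemma singular_system_bound:
  "(\<And>j. j < n \<Longrightarrow> cinner v (e j) = 0) \<Longrightarrow> norm (bop_apply X v) \<le> s (Suc n) * norm v"
  using system by (simp add: singular_system_def)

end

context
  assumes separable: "separable_space (euclidean :: 'h::chilbert_space topology)"
    and infinite_dim: "\<not> (\<exists>B :: 'h set. finite B \<and> complex_vector.span B = UNIV)"
begin

lemma cinner_adjoint:
  fixes X :: "'h bop"
  shows "cinner (bop_apply X x) y = cinner x (bop_apply (adjoint_op X) y)"
    and "cinner (bop_apply (adjoint_op X) y) x = cinner y (bop_apply X x)"
proof -
  obtain b :: "nat \<Rightarrow> 'h" where "orthonormal_basis b"
    using exists_orthonormal_basis[OF separable infinite_dim] by blast
  then show *: "cinner (bop_apply X x) y = cinner x (bop_apply (adjoint_op X) y)"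
    by (rule cinner_adjoint_op)
  then show "cinner (bop_apply (adjoint_op X) y) x = cinner y (bop_apply X x)"
    by (metis cinner_commute)
qed

lemma cinner_adjoint_mult:
  fixes X :: "'h bop"
  shows "cinner (bop_apply (adjoint_op X * X) v) w = cinner (bop_apply X v) (bop_apply X w)"
    and "cinner v (bop_apply (adjoint_op X * X) w) = cinner (bop_apply X v) (bop_apply X w)"
  by (simp add: cinner_adjoint(2)) (simp flip: cinner_adjoint(1))

text \<open>If \<open>X\<close> is not compact, then for some \<open>\<delta> > 0\<close> every closed subspace of finite codimension contains
unit vectors \<open>v\<close> with \<open>\<parallel>X v\<parallel> > \<delta>\<close>. Choosing \<open>e\<^sub>n\<close> orthogonal to \<open>e\<^sub>j\<close> and \<open>X\<^sup>*X e\<^sub>j\<close> for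
\<open>j < n\<close> makes the vectors \<open>X e\<^sub>n\<close> orthogonal too. Therefore \<open>W X V\<close> is the identity for an
isometry \<open>V\<close> and a bounded \<open>W\<close>, and the ideal contains every operator.\<close>

lemma proper_ideal_compact:
  fixes I :: "'h bop set"
  assumes I: "proper_ideal I" and X: "X \<in> I"
  shows "compact_bop X"
proof (rule ccontr)
  assume "\<not> compact_bop X"
  then obtain \<delta> where \<delta>: "\<delta> > 0"
    and big: "\<And>S. finite S \<Longrightarrow> \<exists>v. (\<forall>s\<in>S. cinner v s = 0) \<and> \<delta> * norm v < norm (bop_apply X v)"
    unfolding compact_bop_def by (meson not_le)
  let ?A = "adjoint_op X * X"
  have "\<exists>e :: nat \<Rightarrow> 'h. orthonormal UNIV e \<and>
      (\<forall>n. \<delta> < norm (bop_apply X (e n)) \<and> (\<forall>j<n. cinner (e n) (bop_apply ?A (e j)) = 0))"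
  proof (rule orthonormal_sequence_choice[where Q = "\<lambda>n e v. \<delta> < norm (bop_apply X v) \<and>
      (\<forall>j<n. cinner v (bop_apply ?A (e j)) = 0)"])
    fix n and e :: "nat \<Rightarrow> 'h"
    obtain v where v: "\<forall>s \<in> e ` {..<n} \<union> bop_apply ?A ` e ` {..<n}. cinner v s = 0"
      "\<delta> * norm v < norm (bop_apply X v)"
      using big[of "e ` {..<n} \<union> bop_apply ?A ` e ` {..<n}"] by auto
    have v0: "v \<noteq> 0" using v(2) by auto
    define u where "u = (1 / complex_of_real (norm v)) *\<^sub>C v"
    have "\<delta> < norm (bop_apply X u)"
      using v(2) v0 by (simp add: u_def bop_scaleC norm_scaleC norm_divide field_simps)
    then show "\<exists>v. norm v = 1 \<and> (\<forall>j<n. cinner v (e j) = 0) \<and> \<delta> < norm (bop_apply X v) \<and>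
        (\<forall>j<n. cinner v (bop_apply ?A (e j)) = 0)"
      using norm_normalized[OF v0] v(1)
      by (intro exI[of _ u]) (auto simp: u_def cinner_scaleC_left)
  qed simp
  then obtain e :: "nat \<Rightarrow> 'h" where e: "orthonormal UNIV e" and props: "\<forall>n. \<delta> < norm (bop_apply X (e n)) \<and>
      (\<forall>j<n. cinner (e n) (bop_apply ?A (e j)) = 0)"
    by (elim exE conjE)
  from props have large: "\<And>n. \<delta> < norm (bop_apply X (e n))"
    and orth: "\<And>j n. j < n \<Longrightarrow> cinner (e n) (bop_apply ?A (e j)) = 0" by simp_all
  define g where "g = (\<lambda>n. (1 / complex_of_real (norm (bop_apply X (e n)))) *\<^sub>C bop_apply X (e n))"
  have pos: "norm (bop_apply X (e n)) > 0" for n using large[of n] \<delta> by linarith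
  have gg: "cinner (g n) (g j) = 0" if "j < n" for j n
    using orth[OF that] unfolding cinner_adjoint_mult
    by (simp add: g_def cinner_scaleC_left cinner_scaleC_right)
  have g: "orthonormal UNIV g"
    unfolding orthonormal_def
  proof (intro ballI)
    fix i j :: nat
    have "norm (g i) = 1" unfolding g_def using pos[of i] by (intro norm_normalized) auto
    then have "cinner (g i) (g i) = 1" by (simp add: cinner_self)
    moreover have "cinner (g i) (g j) = 0" if "i \<noteq> j"
      using gg[of i j] gg[of j i] that cinner_eq_0_commute[of "g i" "g j"]
      by (cases i j rule: linorder_cases) auto
    ultimately show "cinner (g i) (g j) = (if i = j then 1 else 0)"
      by (cases "i = j") simp_all
  qed
  obtain b :: "nat \<Rightarrow> 'h" where b: "orthonormal_basis b"
    using exists_orthonormal_basis[OF separable infinite_dim] by blast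
  then have on: "orthonormal UNIV b" by (simp add: orthonormal_basis_def)
  obtain V where V: "\<And>i. bop_apply V (b i) = e i"
    using diagonal_map_exists[OF on e, of "\<lambda>_. 1" 1] by (auto simp: scaleC_one)
  have "cmod (1 / complex_of_real (norm (bop_apply X (e i)))) \<le> 1 / \<delta>" for i
    using large[of i] \<delta> by (simp add: norm_divide frac_le)
  from diagonal_map_exists[OF g on, of "\<lambda>i. 1 / complex_of_real (norm (bop_apply X (e i)))", OF this]
  obtain W where W: "\<And>i. bop_apply W (g i) = (1 / complex_of_real (norm (bop_apply X (e i)))) *\<^sub>C b i"
    by blast
  have WXV: "bop_apply (W * (X * V)) (b i) = b i" for i
  proof -
    have "bop_apply X (e i) = complex_of_real (norm (bop_apply X (e i))) *\<^sub>C g i"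
      using pos[of i] by (simp add: g_def scaleC_scaleC scaleC_one)
    then have "bop_apply W (bop_apply X (e i)) = complex_of_real (norm (bop_apply X (e i))) *\<^sub>C bop_apply W (g i)"
      by (metis bop_scaleC)
    also have "\<dots> = b i" using pos[of i] by (simp add: W scaleC_scaleC scaleC_one)
    finally show ?thesis by (simp add: V)
  qed
  have "Y \<in> I" for Y
  proof -
    have "Y * (W * (X * V)) = Y"
      using WXV by (intro bop_eq_on_basis[OF b]) simp
    moreover have "Y * (W * (X * V)) \<in> I" using I X unfolding proper_ideal_def by blast
    ultimately show ?thesis by simp
  qed
  then show False using I unfolding proper_ideal_def by blast
qed

text \<open>The norm \<open>\<mu>\<close> of \<open>X\<close> on the orthogonal complement \<open>M\<close> of \<open>S\<close> is attained, and at an eigenvector.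
The space \<open>M\<close> is invariant under \<open>X\<^sup>*X\<close>, and along a maximizing sequence of unit vectors
\<open>X\<^sup>*X v\<^sub>k - \<mu>\<^sup>2 v\<^sub>k\<close> tends to \<open>0\<close>. After passing to a subsequence whose components in the finitely many
directions provided by compactness converge, the differences \<open>v\<^sub>m - v\<^sub>n\<close> lie almost entirely where
\<open>X\<close> is small. As \<open>X\<^sup>*X\<close> acts on them almost like \<open>\<mu>\<^sup>2\<close>, they must be small themselves.\<close>

lemma singular_vector_exists:
  fixes X :: "'h bop"
  assumes X: "compact_bop X" and S: "finite S"
    and inv: "\<forall>s\<in>S. \<exists>c. bop_apply (adjoint_op X * X) s = c *\<^sub>C s"
  shows "\<exists>v \<mu>. norm v = 1 \<and> (\<forall>s\<in>S. cinner v s = 0) \<and> 0 \<le> \<mu> \<and>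
    bop_apply (adjoint_op X * X) v = complex_of_real (\<mu>\<^sup>2) *\<^sub>C v \<and>
    (\<forall>w. (\<forall>s\<in>S. cinner w s = 0) \<longrightarrow> norm (bop_apply X w) \<le> \<mu> * norm w)"
proof -
  let ?A = "adjoint_op X * X"
  define M where "M = {v. \<forall>s\<in>S. cinner v s = 0}"
  define U where "U = {v \<in> M. norm v = 1}"
  obtain K where K: "K \<ge> 0" "\<And>x. norm (bop_apply X x) \<le> K * norm x"
    using bop_bounded[of X] by blast
  obtain u where u: "u \<in> U"
    using orthogonal_unit_vector[OF infinite_dim S] by (auto simp: U_def M_def)
  define \<mu> where "\<mu> = (SUP v\<in>U. norm (bop_apply X v))"
  have bdd: "bdd_above ((\<lambda>v. norm (bop_apply X v)) ` U)"
    unfolding bdd_above_def using K(2) by (intro exI[of _ K]) (auto simp: U_def intro: order_trans[OF K(2)])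
  have upper: "norm (bop_apply X v) \<le> \<mu>" if "v \<in> U" for v
    unfolding \<mu>_def by (rule cSUP_upper[OF that bdd])
  have \<mu>0: "\<mu> \<ge> 0" using upper[OF u] norm_ge_zero order_trans by blast
  have boundM: "norm (bop_apply X w) \<le> \<mu> * norm w" if w: "w \<in> M" for w
  proof (cases "w = 0")
    case False
    define v where "v = (1 / complex_of_real (norm w)) *\<^sub>C w"
    have "v \<in> U"
      using w norm_normalized[OF False] by (simp add: U_def M_def v_def cinner_scaleC_left)
    from upper[OF this] show ?thesis
      using False by (simp add: v_def bop_scaleC norm_scaleC norm_divide field_simps)
  qed simp
  have AM: "bop_apply ?A v \<in> M" if v: "v \<in> M" for v
  proof -
    have "cinner (bop_apply ?A v) s = 0" if s: "s \<in> S" for s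
    proof -
      obtain c where "bop_apply ?A s = c *\<^sub>C s" using inv s by blast
      then have "cinner v (bop_apply ?A s) = 0"
        using v s by (simp add: M_def cinner_scaleC_right del: bop_apply_simps)
      then show ?thesis by (simp only: cinner_adjoint_mult)
    qed
    then show ?thesis by (simp add: M_def)
  qed
  have "\<exists>v\<in>U. bop_apply ?A v = complex_of_real (\<mu>\<^sup>2) *\<^sub>C v"
  proof (cases "\<mu> = 0")
    case True
    then have "bop_apply X u = 0" using upper[OF u] by simp
    then show ?thesis using u True by (intro bexI[of _ u]) auto
  next
    case False
    then have \<mu>: "\<mu> > 0" using \<mu>0 by simp
    have "\<exists>v\<in>U. \<mu> - inverse (real (Suc k)) < norm (bop_apply X v)" for k
    proof -
      have "\<mu> - inverse (real (Suc k)) < (SUP v\<in>U. norm (bop_apply X v))"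
        unfolding \<mu>_def[symmetric] by simp
      then show ?thesis using less_cSUP_iff[OF _ bdd] u by blast
    qed
    then obtain v where vU: "\<And>k. v k \<in> U"
      and v_low: "\<And>k. \<mu> - inverse (real (Suc k)) < norm (bop_apply X (v k))" by metis
    have v1: "norm (v k) = 1" and vM: "v k \<in> M" for k using vU[of k] by (auto simp: U_def)
    have Xv: "(\<lambda>k. norm (bop_apply X (v k))) \<longlonglongrightarrow> \<mu>"
    proof (rule tendsto_sandwich[of "\<lambda>k. \<mu> - inverse (real (Suc k))" _ _ "\<lambda>_. \<mu>"])
      show "(\<lambda>k. \<mu> - inverse (real (Suc k))) \<longlonglongrightarrow> \<mu>"
        using tendsto_diff[OF tendsto_const LIMSEQ_inverse_real_of_nat, of \<mu>] by simp
    qed (use v_low upper[OF vU] in \<open>auto intro!: always_eventually less_imp_le\<close>)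
    define d where "d = (\<lambda>k. bop_apply ?A (v k) - complex_of_real (\<mu>\<^sup>2) *\<^sub>C v k)"
    have d_le: "(norm (d k))\<^sup>2 \<le> 2 * \<mu>\<^sup>2 * (\<mu>\<^sup>2 - (norm (bop_apply X (v k)))\<^sup>2)" for k
    proof -
      let ?a = "norm (bop_apply ?A (v k))" and ?x = "norm (bop_apply X (v k))"
      have "?a\<^sup>2 = cmod (cinner (bop_apply ?A (v k)) (bop_apply ?A (v k)))"
        by (simp only: cinner_self norm_of_real abs_power2)
      also have "\<dots> = cmod (cinner (bop_apply X (v k)) (bop_apply X (bop_apply ?A (v k))))"
        by (simp only: cinner_adjoint_mult(1))
      also have "\<dots> \<le> \<mu> * (\<mu> * ?a)"
        using upper[OF vU] boundM[OF AM[OF vM]] \<mu>0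
        by (intro order_trans[OF cauchy_schwarz] mult_mono) auto
      finally have "?a * ?a \<le> \<mu>\<^sup>2 * ?a" by (simp only: power2_eq_square mult_ac)
      then have "?a \<le> \<mu>\<^sup>2" using zero_le_power2[of \<mu>] mult_le_cancel_right[of ?a ?a "\<mu>\<^sup>2"] norm_ge_zero[of "bop_apply ?A (v k)"]
        by linarith
      then have a: "?a\<^sup>2 \<le> \<mu>\<^sup>2 * \<mu>\<^sup>2" by (simp only: power2_eq_square[of ?a] mult_mono norm_ge_zero zero_le_power2)
      have re: "Re (cinner (bop_apply ?A (v k)) (complex_of_real (\<mu>\<^sup>2) *\<^sub>C v k)) = \<mu>\<^sup>2 * ?x\<^sup>2"
        by (simp only: cinner_scaleC_right cinner_adjoint_mult cinner_self)
          (simp flip: of_real_power of_real_mult)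
      have nm: "norm (complex_of_real (\<mu>\<^sup>2) *\<^sub>C v k) = \<mu>\<^sup>2" by (simp add: norm_scaleC v1 flip: of_real_power)
      have "(norm (d k))\<^sup>2 = ?a\<^sup>2 - 2 * (\<mu>\<^sup>2 * ?x\<^sup>2) + \<mu>\<^sup>2 * \<mu>\<^sup>2"
        unfolding d_def norm_diff_squared re nm by (simp only: power2_eq_square[of "\<mu>\<^sup>2"])
      then show ?thesis using a by (simp only: right_diff_distrib mult.assoc)
    qed
    have d0: "d \<longlonglongrightarrow> 0"
    proof -
      have "(\<lambda>k. 2 * \<mu>\<^sup>2 * (\<mu>\<^sup>2 - (norm (bop_apply X (v k)))\<^sup>2)) \<longlonglongrightarrow> 2 * \<mu>\<^sup>2 * (\<mu>\<^sup>2 - \<mu>\<^sup>2)"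
        by (intro tendsto_intros Xv)
      then have "(\<lambda>k. (norm (d k))\<^sup>2) \<longlonglongrightarrow> 0"
        by (intro tendsto_sandwich[of "\<lambda>_. 0" "\<lambda>k. (norm (d k))\<^sup>2" _ "\<lambda>k. 2 * \<mu>\<^sup>2 * (\<mu>\<^sup>2 - (norm (bop_apply X (v k)))\<^sup>2)"])
          (auto intro!: always_eventually d_le)
      then have "(\<lambda>k. sqrt ((norm (d k))\<^sup>2)) \<longlonglongrightarrow> sqrt 0" by (rule tendsto_real_sqrt)
      then show ?thesis by (simp add: tendsto_norm_zero_iff)
    qed
    obtain L where L: "L \<ge> 0" "\<And>x. norm (bop_apply (adjoint_op X) x) \<le> L * norm x"
      using bop_bounded[of "adjoint_op X"] by blast
    \<comment> \<open>With this choice \<open>L * \<delta> \<le> \<mu>\<^sup>2 / 2\<close>, so that the contribution of the directions where \<open>X\<close> is small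
      can be absorbed into \<open>\<mu>\<^sup>2 * norm x\<close> in the estimate of \<open>dist\<close> below.\<close>
    define \<delta> where "\<delta> = \<mu>\<^sup>2 / (2 * (L + 1))"
    have \<delta>: "\<delta> > 0" using \<mu> L by (simp add: \<delta>_def)
    obtain B where B: "finite B" "orthonormal B (\<lambda>x. x)"
      "\<And>v. (\<forall>s\<in>B. cinner v s = 0) \<Longrightarrow> norm (bop_apply X v) \<le> \<delta> * norm v"
      using compact_bop_orthonormal[OF X \<delta>] by blast
    have "cmod (cinner (v k) b) \<le> norm b" for b k
      using cauchy_schwarz[of "v k" b] by (simp add: v1)
    then obtain r where r: "strict_mono r" "\<And>b. b \<in> B \<Longrightarrow> \<exists>l. (\<lambda>k. cinner (v (r k)) b) \<longlonglongrightarrow> l"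
      using convergent_subsequence_finite[OF B(1), of "\<lambda>b k. cinner (v k) b" norm] by blast
    obtain l where l: "\<And>b. b \<in> B \<Longrightarrow> (\<lambda>k. cinner (v (r k)) b) \<longlonglongrightarrow> l b"
      using r(2) by metis
    define \<rho> where "\<rho> = (\<lambda>k. \<Sum>b\<in>B. cmod (cinner (v (r k)) b - l b))"
    \<comment> \<open>The estimate of a difference splits into one term for each of the two indices, which makes the
      Cauchy property immediate.\<close>
    define \<theta> where "\<theta> = (\<lambda>k. 2 / \<mu>\<^sup>2 * (L * K * \<rho> k + norm (d (r k))))"
    have "\<rho> \<longlonglongrightarrow> (\<Sum>b\<in>B. 0)"
      unfolding \<rho>_def using l by (intro tendsto_sum tendsto_norm_zero) (simp add: LIM_zero)
    moreover have dr: "(\<lambda>k. d (r k)) \<longlonglongrightarrow> 0"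
      using LIMSEQ_subseq_LIMSEQ[OF d0 r(1)] by (simp add: o_def)
    ultimately have "\<theta> \<longlonglongrightarrow> 2 / \<mu>\<^sup>2 * (L * K * 0 + 0)"
      unfolding \<theta>_def by (intro tendsto_intros tendsto_norm_zero) auto
    then have \<theta>: "\<theta> \<longlonglongrightarrow> 0" by simp
    have dist: "dist (v (r m)) (v (r n)) \<le> \<theta> m + \<theta> n" for m n
    proof -
      define x where "x = v (r m) - v (r n)"
      let ?p = "proj B (\<lambda>x. x) x"
      have p: "norm ?p \<le> \<rho> m + \<rho> n"
      proof -
        have "norm ?p \<le> (\<Sum>b\<in>B. cmod (cinner x b))" by (rule norm_proj_le[OF B(2,1)])
        also have "\<dots> \<le> (\<Sum>b\<in>B. cmod (cinner (v (r m)) b - l b) + cmod (cinner (v (r n)) b - l b))"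
        proof (intro sum_mono)
          fix b
          have "cinner x b = (cinner (v (r m)) b - l b) - (cinner (v (r n)) b - l b)"
            by (simp add: x_def cinner_diff_left)
          then show "cmod (cinner x b) \<le> cmod (cinner (v (r m)) b - l b) + cmod (cinner (v (r n)) b - l b)"
            by (metis norm_triangle_ineq4)
        qed
        finally show ?thesis by (simp add: \<rho>_def sum.distrib)
      qed
      have Xx: "norm (bop_apply X x) \<le> K * (\<rho> m + \<rho> n) + \<delta> * norm x"
      proof -
        have "norm (bop_apply X x) \<le> norm (bop_apply X ?p) + norm (bop_apply X (x - ?p))"
          using norm_triangle_ineq[of "bop_apply X ?p" "bop_apply X (x - ?p)"] by (simp add: bop_diff)
        moreover have "norm (bop_apply X ?p) \<le> K * (\<rho> m + \<rho> n)"
          using K(2)[of ?p] p K(1) mult_left_mono order_trans by blast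
        moreover have "norm (bop_apply X (x - ?p)) \<le> \<delta> * norm (x - ?p)"
          using cinner_residual[OF B(2,1)] by (intro B(3)) simp
        moreover have "\<delta> * norm (x - ?p) \<le> \<delta> * norm x"
          using \<delta> norm_residual_le[OF B(2,1)] by (intro mult_left_mono) auto
        ultimately show ?thesis by linarith
      qed
      have "\<mu>\<^sup>2 * norm x = norm (complex_of_real (\<mu>\<^sup>2) *\<^sub>C x)"
        by (simp add: norm_scaleC flip: of_real_power)
      also have "complex_of_real (\<mu>\<^sup>2) *\<^sub>C x = bop_apply ?A x - (d (r m) - d (r n))"
        by (simp add: x_def d_def bop_diff complex_vector.scale_right_diff_distrib)
      also have "norm \<dots> \<le> norm (bop_apply ?A x) + (norm (d (r m)) + norm (d (r n)))"
        by (intro order_trans[OF norm_triangle_ineq4] add_left_mono norm_triangle_ineq4)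
      also have "norm (bop_apply ?A x) \<le> L * (K * (\<rho> m + \<rho> n) + \<delta> * norm x)"
        using L(2)[of "bop_apply X x"] mult_left_mono[OF Xx L(1)] by simp
      also have "L * (K * (\<rho> m + \<rho> n) + \<delta> * norm x) \<le> L * K * (\<rho> m + \<rho> n) + \<mu>\<^sup>2 / 2 * norm x"
      proof -
        have "L * \<delta> \<le> \<mu>\<^sup>2 / 2" using L(1) by (simp add: \<delta>_def field_simps)
        then have "L * \<delta> * norm x \<le> \<mu>\<^sup>2 / 2 * norm x" by (intro mult_right_mono) auto
        then show ?thesis by (simp add: distrib_left mult.assoc)
      qed
      finally have "\<mu>\<^sup>2 * norm x \<le> 2 * (L * K * (\<rho> m + \<rho> n) + (norm (d (r m)) + norm (d (r n))))"
        by simp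
      then have "norm x \<le> 2 * (L * K * (\<rho> m + \<rho> n) + (norm (d (r m)) + norm (d (r n)))) / \<mu>\<^sup>2"
        using \<mu> by (simp add: pos_le_divide_eq mult.commute)
      also have "\<dots> = \<theta> m + \<theta> n"
        by (simp add: \<theta>_def algebra_simps add_divide_distrib)
      finally show ?thesis by (simp add: x_def dist_norm)
    qed
    have "Cauchy (\<lambda>k. v (r k))" using Cauchy_if_dist_le[OF \<theta> dist] .
    then obtain w where w: "(\<lambda>k. v (r k)) \<longlonglongrightarrow> w"
      using Cauchy_convergent_iff convergent_def by blast
    have "norm w = 1"
      using LIMSEQ_unique[OF tendsto_norm[OF w]] v1 by simp
    moreover have "cinner w s = 0" if "s \<in> S" for s
    proof -
      have "(\<lambda>k. cinner (v (r k)) s) \<longlonglongrightarrow> cinner w s" by (rule tendsto_cinner_left[OF w])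
      moreover have "cinner (v (r k)) s = 0" for k using vM[of "r k"] that by (simp add: M_def)
      ultimately show ?thesis by (simp add: LIMSEQ_const_iff)
    qed
    moreover have "bop_apply ?A w - complex_of_real (\<mu>\<^sup>2) *\<^sub>C w = 0"
    proof (rule LIMSEQ_unique)
      show "(\<lambda>k. d (r k)) \<longlonglongrightarrow> bop_apply ?A w - complex_of_real (\<mu>\<^sup>2) *\<^sub>C w"
        unfolding d_def by (intro tendsto_diff bop_tendsto tendsto_scaleC w)
    qed (rule dr)
    ultimately show ?thesis by (intro bexI[of _ w]) (auto simp: U_def M_def)
  qed
  then show ?thesis using \<mu>0 boundM by (auto simp: U_def M_def)
qed

lemma singular_system_cinner_image:
  fixes X :: "'h bop"
  assumes "singular_system X s e"
  shows "cinner (bop_apply X (e i)) (bop_apply X (e j)) =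
    (if i = j then complex_of_real ((s (Suc i))\<^sup>2) else 0)"
proof -
  have "cinner (bop_apply X (e i)) (bop_apply X (e j)) =
      cinner (bop_apply (adjoint_op X * X) (e i)) (e j)"
    by (simp only: cinner_adjoint_mult)
  then show ?thesis
    using singular_system_orthonormal[OF assms] singular_system_eigenvector[OF assms]
    by (simp add: cinner_scaleC_left orthonormal_def del: bop_apply_simps)
qed

lemma singular_system_norm_image:
  fixes X :: "'h bop"
  assumes "singular_system X s e"
  shows "norm (bop_apply X (e n)) = s (Suc n)"
proof -
  have "(norm (bop_apply X (e n)))\<^sup>2 = (s (Suc n))\<^sup>2"
    using singular_system_cinner_image[OF assms, of n n] unfolding cinner_self
    by (simp flip: of_real_power)
  then show ?thesis
    using singular_system_nonneg[OF assms] by (simp add: power2_eq_iff_nonneg)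
qed

lemma singular_system_antimono:
  fixes X :: "'h bop"
  assumes "singular_system X s e"
  shows "antimono_on {1..} s"
proof -
  have "s (Suc (n + k)) \<le> s (Suc n)" for n k
  proof -
    have "cinner (e (n + k)) (e j) = 0" if "j < n" for j
      using singular_system_orthonormal[OF assms] that by (simp add: orthonormal_def)
    then have "norm (bop_apply X (e (n + k))) \<le> s (Suc n) * norm (e (n + k))"
      by (rule singular_system_bound[OF assms])
    then show ?thesis
      using singular_system_norm_image[OF assms] orthonormal_norm[OF singular_system_orthonormal[OF assms]]
      by simp
  qed
  note le = this
  show ?thesis
  proof (rule monotone_onI)
    fix m n :: nat assume "m \<in> {1..}" "n \<in> {1..}" "m \<le> n"
    then obtain i k where "m = Suc i" "n = Suc (i + k)"
      by (metis Suc_le_D add_Suc atLeast_iff le_Suc_ex One_nat_def)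
    then show "s n \<le> s m" using le by simp
  qed
qed

text \<open>An orthonormal sequence converges weakly to \<open>0\<close>, so its components in any finite set of directions
disappear in the limit, and in the remaining directions \<open>X\<close> is small.\<close>

lemma singular_system_tendsto_0:
  fixes X :: "'h bop"
  assumes X: "compact_bop X" and sys: "singular_system X s e"
  shows "s \<longlonglongrightarrow> 0"
proof -
  have "(\<lambda>n. s (Suc n)) \<longlonglongrightarrow> 0"
  proof (rule order_tendstoI)
    fix a :: real assume "a < 0"
    then show "\<forall>\<^sub>F n in sequentially. a < s (Suc n)"
      using less_le_trans[OF _ singular_system_nonneg[OF sys]]
      by (intro always_eventually allI) blast
  next
    fix a :: real assume a: "0 < a"
    obtain B where B: "finite B" "orthonormal B (\<lambda>x. x)"
      "\<And>v. (\<forall>s\<in>B. cinner v s = 0) \<Longrightarrow> norm (bop_apply X v) \<le> a / 2 * norm v"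
      using compact_bop_orthonormal[OF X, of "a / 2"] a by auto
    obtain K where K: "K \<ge> 0" "\<And>x. norm (bop_apply X x) \<le> K * norm x"
      using bop_bounded[of X] by blast
    let ?\<rho> = "\<lambda>n. \<Sum>b\<in>B. cmod (cinner b (e n))"
    have "(\<lambda>n. K * ?\<rho> n) \<longlonglongrightarrow> K * (\<Sum>b\<in>B. 0)"
      by (intro tendsto_mult tendsto_const tendsto_sum tendsto_norm_zero
          cinner_orthonormal_tendsto_0 singular_system_orthonormal[OF sys])
    then have "\<forall>\<^sub>F n in sequentially. K * ?\<rho> n < a / 2"
      using a by (intro order_tendstoD) auto
    then show "\<forall>\<^sub>F n in sequentially. s (Suc n) < a"
    proof eventually_elim
      case (elim n)
      let ?p = "proj B (\<lambda>x. x) (e n)"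
      have en: "norm (e n) = 1" using orthonormal_norm[OF singular_system_orthonormal[OF sys]] by simp
      have "norm ?p \<le> ?\<rho> n"
        by (rule order_trans[OF norm_proj_le[OF B(2,1)]]) (subst cinner_commute, simp)
      then have "norm (bop_apply X ?p) \<le> K * ?\<rho> n"
        using K(2)[of ?p] mult_left_mono[OF _ K(1)] order_trans by blast
      moreover have "norm (bop_apply X (e n - ?p)) \<le> a / 2 * norm (e n - ?p)"
        using cinner_residual[OF B(2,1)] by (intro B(3)) simp
      moreover have "a / 2 * norm (e n - ?p) \<le> a / 2"
        using norm_residual_le[OF B(2,1), of "e n"] a en by simp
      moreover have "norm (bop_apply X (e n)) \<le> norm (bop_apply X ?p) + norm (bop_apply X (e n - ?p))"
        using norm_triangle_ineq[of "bop_apply X ?p" "bop_apply X (e n - ?p)"] by (simp add: bop_diff)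
      ultimately show ?case using elim singular_system_norm_image[OF sys, of n] by linarith
    qed
  qed
  then show ?thesis by (rule LIMSEQ_imp_Suc)
qed

lemma singular_system_exists:
  fixes X :: "'h bop"
  assumes "compact_bop X"
  shows "\<exists>s e. singular_system X s e"
proof -
  let ?Q = "\<lambda>n e v. \<exists>\<mu>\<ge>0. bop_apply (adjoint_op X * X) v = complex_of_real (\<mu>\<^sup>2) *\<^sub>C v \<and>
      (\<forall>w. (\<forall>j<n. cinner w (e j) = 0) \<longrightarrow> norm (bop_apply X w) \<le> \<mu> * norm w)"
  have "\<exists>e :: nat \<Rightarrow> 'h. orthonormal UNIV e \<and> (\<forall>n. ?Q n e (e n))"
  proof (rule orthonormal_sequence_choice[where Q = ?Q])
    fix n :: nat and e :: "nat \<Rightarrow> 'h"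
    assume "\<And>j. j < n \<Longrightarrow> ?Q j e (e j)"
    then have inv: "\<forall>s\<in>e ` {..<n}. \<exists>c. bop_apply (adjoint_op X * X) s = c *\<^sub>C s"
      by blast
    show "\<exists>v. norm v = 1 \<and> (\<forall>j<n. cinner v (e j) = 0) \<and> ?Q n e v"
    proof -
      have "finite (e ` {..<n})" by simp
      from singular_vector_exists[OF assms this inv]
      obtain v \<mu> where v: "norm v = 1" "\<forall>s\<in>e ` {..<n}. cinner v s = 0" "0 \<le> \<mu>"
        "bop_apply (adjoint_op X * X) v = complex_of_real (\<mu>\<^sup>2) *\<^sub>C v"
        "\<forall>w. (\<forall>s\<in>e ` {..<n}. cinner w s = 0) \<longrightarrow> norm (bop_apply X w) \<le> \<mu> * norm w"
        by (elim exE conjE)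
      from v(5) have "\<forall>w. (\<forall>j<n. cinner w (e j) = 0) \<longrightarrow> norm (bop_apply X w) \<le> \<mu> * norm w"
        by simp
      with v show ?thesis by (intro exI[of _ v] conjI exI[of _ \<mu>]) simp_all
    qed
  qed simp
  then obtain e :: "nat \<Rightarrow> 'h" where e: "orthonormal UNIV e" and "\<forall>n. ?Q n e (e n)"
    by (elim exE conjE)
  then obtain \<mu> where \<mu>: "\<And>n. 0 \<le> \<mu> n \<and> bop_apply (adjoint_op X * X) (e n) = complex_of_real ((\<mu> n)\<^sup>2) *\<^sub>C e n \<and>
      (\<forall>w. (\<forall>j<n. cinner w (e j) = 0) \<longrightarrow> norm (bop_apply X w) \<le> \<mu> n * norm w)"
    by metis
  have "singular_system X (\<lambda>n. case n of 0 \<Rightarrow> 0 | Suc m \<Rightarrow> \<mu> m) e"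
    using e \<mu> by (simp add: singular_system_def)
  then show ?thesis by blast
qed

text \<open>Subtract from an eigenvector its components along the \<open>e\<^sub>i\<close> that belong to \<open>\<sigma>\<close>. The rest is
orthogonal to every \<open>e\<^sub>i\<close>, hence annihilated by \<open>X\<close> because the singular values tend to \<open>0\<close>; being
also an eigenvector for \<open>\<sigma>\<^sup>2 \<noteq> 0\<close>, it vanishes.\<close>

lemma singular_system_eigenspace:
  fixes X :: "'h bop"
  assumes X: "compact_bop X" and sys: "singular_system X s e" and \<sigma>: "\<sigma> > 0"
  shows "sv_eigenspace X \<sigma> = complex_vector.span (e ` {i. s (Suc i) = \<sigma>})"
proof
  let ?A = "adjoint_op X * X" and ?J = "{i. s (Suc i) = \<sigma>}"
  note on = singular_system_orthonormal[OF sys]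
  note eig = singular_system_eigenvector[OF sys]
  have s0: "(\<lambda>n. s (Suc n)) \<longlonglongrightarrow> 0"
    using LIMSEQ_Suc[OF singular_system_tendsto_0[OF X sys]] .
  then have "\<forall>\<^sub>F n in sequentially. s (Suc n) < \<sigma>"
    using \<sigma> by (intro order_tendstoD)
  then obtain N where "\<And>n. n \<ge> N \<Longrightarrow> s (Suc n) < \<sigma>" by (auto simp: eventually_sequentially)
  then have "?J \<subseteq> {..<N}" by (auto simp: not_le[symmetric]) (metis less_irrefl not_le)
  then have J: "finite ?J" by (rule finite_subset) simp
  have subspace: "complex_vector.subspace (sv_eigenspace X \<sigma>)"
    by (rule complex_vector.subspaceI)
      (auto simp: sv_eigenspace_def bop_add bop_scaleC scaleC_add_right scaleC_scaleC mult.commute)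
  have "e ` ?J \<subseteq> sv_eigenspace X \<sigma>" using eig by (auto simp: sv_eigenspace_def)
  then show span_le: "complex_vector.span (e ` ?J) \<subseteq> sv_eigenspace X \<sigma>"
    using subspace by (rule complex_vector.span_minimal)
  show "sv_eigenspace X \<sigma> \<subseteq> complex_vector.span (e ` ?J)"
  proof
    fix v assume v: "v \<in> sv_eigenspace X \<sigma>"
    define w where "w = v - proj ?J e v"
    have p: "proj ?J e v \<in> complex_vector.span (e ` ?J)" by (rule proj_in_span)
    then have w: "w \<in> sv_eigenspace X \<sigma>"
      unfolding w_def using complex_vector.subspace_diff[OF subspace v] span_le by blast
    then have Aw: "bop_apply ?A w = complex_of_real (\<sigma>\<^sup>2) *\<^sub>C w" by (simp add: sv_eigenspace_def)
    have orth: "cinner w (e i) = 0" for i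
    proof (cases "i \<in> ?J")
      case True
      then show ?thesis
        unfolding w_def by (intro cinner_residual[OF orthonormal_subset[OF on subset_UNIV] J])
    next
      case False
      have "cinner (bop_apply ?A w) (e i) = cinner w (bop_apply ?A (e i))"
        by (simp only: cinner_adjoint_mult)
      then have "complex_of_real (\<sigma>\<^sup>2) * cinner w (e i) = complex_of_real ((s (Suc i))\<^sup>2) * cinner w (e i)"
        by (simp only: Aw eig cinner_scaleC_left cinner_scaleC_right complex_cnj_complex_of_real)
      moreover have "\<sigma>\<^sup>2 \<noteq> (s (Suc i))\<^sup>2"
        using False \<sigma> singular_system_nonneg[OF sys, of "Suc i"] by (simp add: power2_eq_iff_nonneg)
      ultimately show ?thesis
        by (simp del: of_real_power)
    qed
    have "norm (bop_apply X w) \<le> 0"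
    proof (rule LIMSEQ_le_const)
      show "(\<lambda>n. s (Suc n) * norm w) \<longlonglongrightarrow> 0"
        using tendsto_mult_right[OF s0, of "norm w"] by simp
      show "\<exists>N. \<forall>n\<ge>N. norm (bop_apply X w) \<le> s (Suc n) * norm w"
        using singular_system_bound[OF sys] orth by blast
    qed
    then have "complex_of_real (\<sigma>\<^sup>2) *\<^sub>C w = 0" using Aw by simp
    then have "w = 0" using \<sigma> by simp
    then show "v \<in> complex_vector.span (e ` ?J)" using p by (simp add: w_def)
  qed
qed

lemma singular_system_is_s_number_seq:
  fixes X :: "'h bop"
  assumes X: "compact_bop X" and sys: "singular_system X s e"
  shows "is_s_number_seq X s"
  unfolding is_s_number_seq_def
proof (intro conjI allI impI)
  fix \<sigma> :: real assume \<sigma>: "\<sigma> > 0"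
  have s0: "s 0 = 0" using sys by (simp add: singular_system_def)
  have "\<forall>\<^sub>F n in sequentially. s n < \<sigma>"
    using singular_system_tendsto_0[OF X sys] \<sigma> by (intro order_tendstoD)
  then obtain N where "\<And>n. n \<ge> N \<Longrightarrow> s n < \<sigma>" by (auto simp: eventually_sequentially)
  then have "{n. s n = \<sigma>} \<subseteq> {..<N}" by (auto simp: not_le[symmetric]) (metis less_irrefl not_le)
  then show "finite {n. s n = \<sigma>}" by (rule finite_subset) simp
  let ?J = "{i. s (Suc i) = \<sigma>}"
  have "n \<in> Suc ` ?J" if "s n = \<sigma>" for n
    using that s0 \<sigma> by (cases n) auto
  then have "{n. s n = \<sigma>} = Suc ` ?J" by auto
  then have "card {n. s n = \<sigma>} = card ?J" by (simp add: card_image)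
  also have "\<dots> = card (e ` ?J)"
    by (rule card_image[symmetric],
        rule orthonormal_inj_on[OF orthonormal_subset[OF singular_system_orthonormal[OF sys] subset_UNIV]])
  also have "\<dots> = complex_vector.dim (complex_vector.span (e ` ?J))"
    by (rule complex_vector.dim_span_eq_card_independent[symmetric], rule orthonormal_independent,
        rule orthonormal_image, rule orthonormal_subset[OF singular_system_orthonormal[OF sys] subset_UNIV])
  also have "\<dots> = complex_vector.dim (sv_eigenspace X \<sigma>)"
    using singular_system_eigenspace[OF X sys \<sigma>] by simp
  finally show "card {n. s n = \<sigma>} = complex_vector.dim (sv_eigenspace X \<sigma>)" .
qed (use sys singular_system_nonneg[OF sys] singular_system_antimono[OF sys] in
      \<open>auto simp: singular_system_def\<close>)

lemma s_numbers_singular_system: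
  fixes X :: "'h bop"
  assumes X: "compact_bop X"
  shows "\<exists>e. singular_system X (s_numbers X) e"
proof -
  obtain s e where sys: "singular_system X s e" using singular_system_exists[OF X] by blast
  have "is_s_number_seq X s" by (rule singular_system_is_s_number_seq[OF X sys])
  then have "s_numbers X = s"
    unfolding s_numbers_def by (blast intro: s_number_seq_unique)
  then show ?thesis using sys by blast
qed


section \<open>Comparison of s-numbers within an ideal\<close>

text \<open>This is the min-max argument. The first \<open>n\<close> singular vectors of \<open>A Z C\<close> span a space of dimension
\<open>n\<close>, which contains some \<open>v \<noteq> 0\<close> such that \<open>C v\<close> is orthogonal to the first \<open>n - 1\<close> singular
vectors of \<open>Z\<close>. For this vector
\<open>s\<^sub>n(A Z C) \<parallel>v\<parallel> \<le> \<parallel>A Z C v\<parallel> \<le> \<parallel>Z C v\<parallel> \<le> s\<^sub>n(Z) \<parallel>v\<parallel>\<close>.\<close>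

lemma s_numbers_contraction_le:
  fixes Z A C :: "'h bop"
  assumes Z: "compact_bop Z" and X: "compact_bop (A * (Z * C))"
    and A: "\<And>x. norm (bop_apply A x) \<le> norm x" and C: "\<And>x. norm (bop_apply C x) \<le> norm x"
  shows "s_numbers (A * (Z * C)) n \<le> s_numbers Z n"
proof (cases n)
  case 0
  then show ?thesis
    using s_numbers_singular_system[OF Z] s_numbers_singular_system[OF X]
    by (auto simp: singular_system_def)
next
  case (Suc m)
  let ?X = "A * (Z * C)" and ?J = "{..m}"
  obtain e where e: "singular_system ?X (s_numbers ?X) e" using s_numbers_singular_system[OF X] by blast
  obtain f where f: "singular_system Z (s_numbers Z) f" using s_numbers_singular_system[OF Z] by blast
  have on: "orthonormal ?J e"
    using singular_system_orthonormal[OF e] by (rule orthonormal_subset) simp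
  have "card ((\<lambda>j. bop_apply (adjoint_op C) (f j)) ` {..<m}) \<le> m"
    using card_image_le[of "{..<m}"] by simp
  then obtain v where v: "v \<in> complex_vector.span (e ` ?J)" "v \<noteq> 0"
      and orth: "\<And>j. j < m \<Longrightarrow> cinner v (bop_apply (adjoint_op C) (f j)) = 0"
    using exists_orthogonal_in_span[OF on, of "(\<lambda>j. bop_apply (adjoint_op C) (f j)) ` {..<m}"] by auto
  define c where "c = (\<lambda>j. cinner v (e j))"
  have v_eq: "v = (\<Sum>j\<in>?J. c j *\<^sub>C e j)"
    using proj_span[OF on _ v(1)] by (simp add: proj_def c_def)
  have upper: "norm (bop_apply ?X v) \<le> s_numbers Z n * norm v"
  proof -
    have "norm (bop_apply ?X v) \<le> norm (bop_apply Z (bop_apply C v))" using A by simp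
    also have "\<dots> \<le> s_numbers Z n * norm (bop_apply C v)"
      unfolding Suc using orth
      by (intro singular_system_bound[OF f]) (simp add: cinner_adjoint)
    also have "\<dots> \<le> s_numbers Z n * norm v"
      by (intro mult_left_mono C singular_system_nonneg[OF f])
    finally show ?thesis .
  qed
  have lower: "(s_numbers ?X n)\<^sup>2 * (norm v)\<^sup>2 \<le> (norm (bop_apply ?X v))\<^sup>2"
  proof -
    let ?t = "s_numbers ?X"
    have "cinner (bop_apply ?X v) (bop_apply ?X v) = cinner (bop_apply (adjoint_op ?X * ?X) v) v"
      by (simp only: cinner_adjoint_mult)
    also have "\<dots> = (\<Sum>j\<in>?J. c j * (complex_of_real ((?t (Suc j))\<^sup>2) * cinner (e j) v))"
      by (subst v_eq) (simp only: bop_sum bop_scaleC singular_system_eigenvector[OF e]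
          cinner_sum_left cinner_scaleC_left)
    also have "\<dots> = complex_of_real (\<Sum>j\<in>?J. (?t (Suc j))\<^sup>2 * (cmod (c j))\<^sup>2)"
      unfolding of_real_sum
    proof (intro sum.cong refl)
      fix j
      have "cinner (e j) v = cnj (c j)" unfolding c_def by (rule cinner_commute)
      then show "c j * (complex_of_real ((?t (Suc j))\<^sup>2) * cinner (e j) v) =
          complex_of_real ((?t (Suc j))\<^sup>2 * (cmod (c j))\<^sup>2)"
        by (simp only: of_real_mult complex_norm_square mult_ac)
    qed
    finally have "(norm (bop_apply ?X v))\<^sup>2 = (\<Sum>j\<in>?J. (?t (Suc j))\<^sup>2 * (cmod (c j))\<^sup>2)"
      unfolding cinner_self of_real_eq_iff .
    moreover have "(\<Sum>j\<in>?J. (?t n)\<^sup>2 * (cmod (c j))\<^sup>2) \<le> (\<Sum>j\<in>?J. (?t (Suc j))\<^sup>2 * (cmod (c j))\<^sup>2)"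
    proof (intro sum_mono mult_right_mono power_mono)
      fix j assume "j \<in> ?J"
      then show "?t n \<le> ?t (Suc j)"
        using monotone_onD[OF singular_system_antimono[OF e], of "Suc j" n] by (simp add: Suc)
    qed (use singular_system_nonneg[OF e] in auto)
    moreover have "(norm v)\<^sup>2 = (\<Sum>j\<in>?J. (cmod (c j))\<^sup>2)"
      by (subst v_eq) (rule norm_orthonormal_sum[OF on], simp)
    ultimately show ?thesis by (simp add: sum_distrib_left)
  qed
  have "(s_numbers ?X n * norm v)\<^sup>2 \<le> (s_numbers Z n * norm v)\<^sup>2"
    unfolding power_mult_distrib
    using lower power_mono[OF upper norm_ge_zero, of 2] by (simp add: power_mult_distrib)
  then have "s_numbers ?X n * norm v \<le> s_numbers Z n * norm v"
    by (rule power2_le_imp_le) (simp add: singular_system_nonneg[OF f])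
  then show ?thesis using v(2) by simp
qed

text \<open>The operator \<open>Z\<close> is the direct sum of \<open>X\<close> and \<open>Y\<close>, carried back to the space itself by two
isometries with orthogonal ranges, which are spanned by the even and by the odd basis vectors. Both
\<open>X\<close> and \<open>Y\<close> are recovered from \<open>Z\<close> by multiplication with contractions.\<close>

lemma ideal_s_numbers_pair:
  fixes I :: "'h bop set"
  assumes I: "proper_ideal I" and X: "X \<in> I" and Y: "Y \<in> I"
  shows "\<exists>Z\<in>I. \<forall>n. s_numbers X n \<le> s_numbers Z n \<and> s_numbers Y n \<le> s_numbers Z n"
proof -
  obtain b :: "nat \<Rightarrow> 'h" where b: "orthonormal_basis b"
    using exists_orthonormal_basis[OF separable infinite_dim] by blast
  then have on: "orthonormal UNIV b" by (simp add: orthonormal_basis_def)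
  define b0 where "b0 = (\<lambda>i. b (2 * i))"
  define b1 where "b1 = (\<lambda>i. b (Suc (2 * i)))"
  have on0: "orthonormal UNIV b0" and on1: "orthonormal UNIV b1"
    using on by (simp_all add: orthonormal_def b0_def b1_def)
  have odd: "Suc (2 * i) \<noteq> 2 * j" "2 * j \<noteq> Suc (2 * i)" for i j :: nat by presburger+
  have orth: "cinner (b0 i) (b1 j) = 0" "cinner (b1 j) (b0 i) = 0" for i j
    using on by (simp_all add: orthonormal_def b0_def b1_def odd)
  obtain V0 where V0: "\<And>i. bop_apply V0 (b i) = b0 i" "\<And>x. norm (bop_apply V0 x) \<le> norm x"
    using diagonal_map_exists[OF on on0, of "\<lambda>_. 1" 1] by (auto simp: scaleC_one)
  obtain V1 where V1: "\<And>i. bop_apply V1 (b i) = b1 i" "\<And>x. norm (bop_apply V1 x) \<le> norm x"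
    using diagonal_map_exists[OF on on1, of "\<lambda>_. 1" 1] by (auto simp: scaleC_one)
  \<comment> \<open>\<open>U0\<close> and \<open>U1\<close> are the adjoints of the isometries \<open>V0\<close> and \<open>V1\<close>.\<close>
  obtain U0 where U0: "\<And>i. bop_apply U0 (b0 i) = b i" "\<And>x. norm (bop_apply U0 x) \<le> norm x"
      "\<And>x. (\<And>i. cinner x (b0 i) = 0) \<Longrightarrow> bop_apply U0 x = 0"
    using diagonal_map_exists[OF on0 on, of "\<lambda>_. 1" 1] by (auto simp: scaleC_one)
  obtain U1 where U1: "\<And>i. bop_apply U1 (b1 i) = b i" "\<And>x. norm (bop_apply U1 x) \<le> norm x"
      "\<And>x. (\<And>i. cinner x (b1 i) = 0) \<Longrightarrow> bop_apply U1 x = 0"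
    using diagonal_map_exists[OF on1 on, of "\<lambda>_. 1" 1] by (auto simp: scaleC_one)
  have prods: "U0 * V1 = 0" "U1 * V0 = 0"
    using U0(3) U1(3) orth by (auto intro!: bop_eq_on_basis[OF b] simp: V0 V1)
  have units: "T * (U0 * V0) = T" "T * (U1 * V1) = T" "U0 * (V0 * T) = T" "U1 * (V1 * T) = T" for T
  proof -
    have "bop_apply (U0 * V0) x = x" "bop_apply (U1 * V1) x = x" for x
    proof -
      obtain E :: "'h bop" where E: "\<And>x. bop_apply E x = x"
        using bop_exists[of "\<lambda>x::'h. x" 1] by auto
      have "U0 * V0 = E" "U1 * V1 = E"
        by (auto intro!: bop_eq_on_basis[OF b] simp: V0 V1 U0 U1 E)
      then show "bop_apply (U0 * V0) x = x" "bop_apply (U1 * V1) x = x" using E by auto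
    qed
    then show "T * (U0 * V0) = T" "T * (U1 * V1) = T" "U0 * (V0 * T) = T" "U1 * (V1 * T) = T"
      by (auto intro!: bop_eqI)
  qed
  define Z where "Z = V0 * (X * U0) + V1 * (Y * U1)"
  have Z: "Z \<in> I" using I X Y unfolding Z_def proper_ideal_def by blast
  have "U0 * (Z * V0) = U0 * (V0 * (X * (U0 * V0))) + U0 * (V1 * (Y * (U1 * V0)))"
    by (simp add: Z_def algebra_simps mult.assoc)
  then have X_eq: "U0 * (Z * V0) = X" by (simp only: units prods) simp
  have "U1 * (Z * V1) = U1 * (V0 * (X * (U0 * V1))) + U1 * (V1 * (Y * (U1 * V1)))"
    by (simp add: Z_def algebra_simps mult.assoc)
  then have Y_eq: "U1 * (Z * V1) = Y" by (simp only: units prods) simp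
  note cpt = proper_ideal_compact[OF I]
  have "s_numbers X n \<le> s_numbers Z n" for n
    using s_numbers_contraction_le[OF cpt[OF Z], of U0 V0] cpt[OF X] X_eq U0(2) V0(2) by simp
  moreover have "s_numbers Y n \<le> s_numbers Z n" for n
    using s_numbers_contraction_le[OF cpt[OF Z], of U1 V1] cpt[OF Y] Y_eq U1(2) V1(2) by simp
  ultimately show ?thesis using Z by blast
qed

lemma ideal_s_numbers_finite:
  fixes I :: "'h bop set"
  assumes I: "proper_ideal I" and F: "finite F" "F \<subseteq> I"
  shows "\<exists>Z\<in>I. \<forall>X\<in>F. \<forall>n. s_numbers X n \<le> s_numbers Z n"
  using F
proof (induction rule: finite_induct)
  case empty
  then show ?case using I by (auto simp: proper_ideal_def)
next
  case (insert X F)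
  then obtain Z where Z: "Z \<in> I" "\<forall>X\<in>F. \<forall>n. s_numbers X n \<le> s_numbers Z n" by auto
  obtain Z' where "Z' \<in> I" "\<forall>n. s_numbers X n \<le> s_numbers Z' n \<and> s_numbers Z n \<le> s_numbers Z' n"
    using ideal_s_numbers_pair[OF I, of X Z] insert.prems Z(1) by auto
  then show ?case using Z(2) by (intro bexI[of _ Z']) (auto intro: order_trans)
qed

end

section \<open>Traces of commutators\<close>

text \<open>For orthonormal \<open>B\<close> this is the trace of the compression of \<open>T\<close> to the span of \<open>B\<close>.\<close>

definition trace_on :: "'h::complex_inner set \<Rightarrow> 'h bop \<Rightarrow> complex" where
  "trace_on B T = (\<Sum>f\<in>B. cinner (bop_apply T f) f)"

text \<open>With \<open>P\<close> the projection onto the span of \<open>B\<close>, the two conditions say that the corners \<open>X (1 - P)\<close>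
and \<open>(1 - P) X P\<close> are small. The second one is imposed on the vectors of \<open>B\<close> only, as these are the
ones that enter the trace.\<close>

definition almost_reduces :: "'h::complex_inner set \<Rightarrow> real \<Rightarrow> 'h bop \<Rightarrow> bool" where
  "almost_reduces B \<epsilon> X \<longleftrightarrow>
     (\<forall>v. (\<forall>f\<in>B. cinner v f = 0) \<longrightarrow> norm (bop_apply X v) \<le> \<epsilon> * norm v) \<and>
     (\<forall>f\<in>B. norm (bop_apply X f - proj B (\<lambda>x. x) (bop_apply X f)) \<le> \<epsilon>)"

text \<open>The commutator of the compressions of \<open>X\<close> and \<open>Y\<close> to the span of \<open>B\<close> has trace \<open>0\<close>. Each of the two
products differs from the product of the compressions by a term with a corner of \<open>X\<close>, which contributes
at most \<open>K \<epsilon>\<close> for every vector of \<open>B\<close>.\<close>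

lemma trace_on_commutator:
  fixes X Y :: "'h::complex_inner bop"
  assumes B: "finite B" "orthonormal B (\<lambda>x. x)" and X: "almost_reduces B \<epsilon> X" and \<epsilon>: "0 \<le> \<epsilon>"
    and Y: "0 \<le> K" "\<And>x. norm (bop_apply Y x) \<le> K * norm x"
  shows "cmod (trace_on B (X * Y - Y * X)) \<le> 2 * K * \<epsilon> * card B"
proof -
  define r where "r = (\<lambda>f. bop_apply Y f - proj B (\<lambda>x. x) (bop_apply Y f))"
  define q where "q = (\<lambda>f. bop_apply X f - proj B (\<lambda>x. x) (bop_apply X f))"
  let ?u = "\<lambda>f. cinner (bop_apply X (r f)) f" and ?w = "\<lambda>f. cinner (bop_apply Y (q f)) f"
  let ?G = "\<lambda>f g. cinner (bop_apply Y f) g * cinner (bop_apply X g) f"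
  have one: "norm f = 1" if "f \<in> B" for f using orthonormal_norm[OF B(2) that] by simp
  have XY: "cinner (bop_apply X (bop_apply Y f)) f = (\<Sum>g\<in>B. ?G f g) + ?u f" for f
  proof -
    have "bop_apply Y f = proj B (\<lambda>x. x) (bop_apply Y f) + r f" by (simp add: r_def)
    then have "bop_apply X (bop_apply Y f) = bop_apply X (proj B (\<lambda>x. x) (bop_apply Y f)) + bop_apply X (r f)"
      by (metis bop_add)
    then show ?thesis
      by (simp add: proj_def bop_sum bop_scaleC cinner_add_left cinner_sum_left cinner_scaleC_left)
  qed
  have YX: "cinner (bop_apply Y (bop_apply X f)) f = (\<Sum>g\<in>B. ?G g f) + ?w f" for f
  proof -
    have "bop_apply X f = proj B (\<lambda>x. x) (bop_apply X f) + q f" by (simp add: q_def)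
    then have "bop_apply Y (bop_apply X f) = bop_apply Y (proj B (\<lambda>x. x) (bop_apply X f)) + bop_apply Y (q f)"
      by (metis bop_add)
    then show ?thesis
      by (simp add: proj_def bop_sum bop_scaleC cinner_add_left cinner_sum_left cinner_scaleC_left mult.commute)
  qed
  have u: "cmod (?u f) \<le> K * \<epsilon>" if f: "f \<in> B" for f
  proof -
    have "\<forall>g\<in>B. cinner (r f) g = 0" using cinner_residual[OF B(2,1)] by (simp add: r_def)
    then have "norm (bop_apply X (r f)) \<le> \<epsilon> * norm (r f)" using X by (simp add: almost_reduces_def)
    also have "\<epsilon> * norm (r f) \<le> \<epsilon> * K"
    proof (rule mult_left_mono[OF _ \<epsilon>])
      have "norm (r f) \<le> norm (bop_apply Y f)" unfolding r_def by (rule norm_residual_le[OF B(2,1)])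
      then show "norm (r f) \<le> K" using Y(2)[of f] one[OF f] by simp
    qed
    finally have "norm (bop_apply X (r f)) \<le> K * \<epsilon>" by (simp add: mult.commute)
    then show ?thesis using cauchy_schwarz[of "bop_apply X (r f)" f] one[OF f] by simp
  qed
  have w: "cmod (?w f) \<le> K * \<epsilon>" if f: "f \<in> B" for f
  proof -
    have "norm (q f) \<le> \<epsilon>" using X f by (simp add: almost_reduces_def q_def)
    then have "norm (bop_apply Y (q f)) \<le> K * \<epsilon>"
      using Y(2)[of "q f"] mult_left_mono[OF _ Y(1)] order_trans by blast
    then show ?thesis using cauchy_schwarz[of "bop_apply Y (q f)" f] one[OF f] by simp
  qed
  have "trace_on B (X * Y - Y * X) = (\<Sum>f\<in>B. \<Sum>g\<in>B. ?G f g) - (\<Sum>f\<in>B. \<Sum>g\<in>B. ?G g f) + (\<Sum>f\<in>B. ?u f - ?w f)"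
    by (simp add: trace_on_def cinner_diff_left XY YX sum.distrib sum_subtractf)
  also have "(\<Sum>f\<in>B. \<Sum>g\<in>B. ?G g f) = (\<Sum>f\<in>B. \<Sum>g\<in>B. ?G f g)" by (rule sum.swap)
  finally have "cmod (trace_on B (X * Y - Y * X)) = cmod (\<Sum>f\<in>B. ?u f - ?w f)" by simp
  also have "\<dots> \<le> (\<Sum>f\<in>B. K * \<epsilon> + K * \<epsilon>)"
    by (intro order_trans[OF norm_sum] sum_mono order_trans[OF norm_triangle_ineq4] add_mono u w)
  finally show ?thesis by (simp add: mult_ac)
qed

text \<open>Since \<open>F\<close> and \<open>C\<close> depend on \<open>T\<close> only, \<open>B\<close> can be adapted afterwards to the finitely many operators
in \<open>F\<close>.\<close>

lemma trace_on_commutator_space: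
  fixes I :: "'h::complex_inner bop set"
  assumes T: "T \<in> commutator_space I"
  shows "\<exists>F C. finite F \<and> F \<subseteq> I \<and> 0 \<le> C \<and>
    (\<forall>B \<epsilon>. finite B \<longrightarrow> orthonormal B (\<lambda>x. x) \<longrightarrow> 0 \<le> \<epsilon> \<longrightarrow> (\<forall>X\<in>F. almost_reduces B \<epsilon> X) \<longrightarrow>
      cmod (trace_on B T) \<le> C * \<epsilon> * card B)"
  using T unfolding commutator_space_def
proof (induction rule: complex_vector.span_induct_alt)
  case base
  show ?case by (intro exI[of _ "{}"] exI[of _ 0]) (simp add: trace_on_def)
next
  case (step c D T)
  obtain F C where F: "finite F" "F \<subseteq> I" "0 \<le> C"
    and C: "\<And>B \<epsilon>. finite B \<Longrightarrow> orthonormal B (\<lambda>x. x) \<Longrightarrow> 0 \<le> \<epsilon> \<Longrightarrow> \<forall>X\<in>F. almost_reduces B \<epsilon> X \<Longrightarrow>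
      cmod (trace_on B T) \<le> C * \<epsilon> * card B"
    using step.IH by blast
  obtain X Y where D: "D = X * Y - Y * X" and X: "X \<in> I" using step.hyps by blast
  obtain K where K: "0 \<le> K" "\<And>x. norm (bop_apply Y x) \<le> K * norm x"
    using bop_bounded[of Y] by blast
  have "cmod (trace_on B (c *\<^sub>C D + T)) \<le> (cmod c * (2 * K) + C) * \<epsilon> * card B"
    if B: "finite B" "orthonormal B (\<lambda>x. x)" "0 \<le> \<epsilon>" and red: "\<forall>X\<in>insert X F. almost_reduces B \<epsilon> X" for B \<epsilon>
  proof -
    have "trace_on B (c *\<^sub>C D + T) = c * trace_on B D + trace_on B T"
      by (simp add: trace_on_def cinner_add_left cinner_scaleC_left sum.distrib sum_distrib_left)
    then have "cmod (trace_on B (c *\<^sub>C D + T)) \<le> cmod c * cmod (trace_on B D) + cmod (trace_on B T)"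
      by (metis norm_triangle_ineq norm_mult)
    moreover have "cmod (trace_on B D) \<le> 2 * K * \<epsilon> * card B"
      unfolding D using red by (intro trace_on_commutator B K) auto
    moreover have "cmod (trace_on B T) \<le> C * \<epsilon> * card B"
      using red by (intro C B) auto
    ultimately show ?thesis
      using mult_left_mono[of "cmod (trace_on B D)" "2 * K * \<epsilon> * card B" "cmod c"]
      by (simp add: algebra_simps)
  qed
  then show ?case
    using F X K(1) by (intro exI[of _ "insert X F"] exI[of _ "cmod c * (2 * K) + C"]) auto
qed

context
  assumes separable: "separable_space (euclidean :: 'h::chilbert_space topology)"
    and infinite_dim: "\<not> (\<exists>B :: 'h set. finite B \<and> complex_vector.span B = UNIV)"
begin

text \<open>Take \<open>B\<close> to contain \<open>b\<^sub>0, \<dots>, b\<^sub>n\<^sub>-\<^sub>1\<close> together with the first \<open>n - 1\<close> right singular vectors of the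
operators in the finite set \<open>F\<close> that belongs to \<open>T\<close>, and their images. It has \<open>O(n)\<close> elements and is
almost reduced by these operators with error \<open>s\<^sub>n(Z)\<close>, which bounds the trace of \<open>T\<close> on \<open>B\<close>. The
elements of \<open>B\<close> other than the \<open>b\<^sub>j\<close> are orthogonal to these, so that by the assumption on the tail
they change the trace by another \<open>O(n s\<^sub>n(Z))\<close> at most.\<close>

lemma commutator_space_diagonal_estimate:
  fixes I :: "'h bop set" and b :: "nat \<Rightarrow> 'h"
  assumes I: "proper_ideal I" and T: "T \<in> commutator_space I" and X0: "X0 \<in> I"
    and b: "orthonormal UNIV b" and M: "0 \<le> M"
    and tail: "\<And>n v. (\<And>j. j < n \<Longrightarrow> cinner v (b j) = 0) \<Longrightarrow>
      norm (bop_apply T v) \<le> M * s_numbers X0 (Suc n) * norm v"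
  shows "\<exists>Z\<in>I. \<exists>C\<ge>0. \<forall>n\<ge>1. cmod (\<Sum>j<n. cinner (bop_apply T (b j)) (b j)) \<le> C * n * s_numbers Z n"
proof -
  obtain F C where F: "finite F" "F \<subseteq> I" "0 \<le> C"
    and trace: "\<And>B \<epsilon>. finite B \<Longrightarrow> orthonormal B (\<lambda>x. x) \<Longrightarrow> 0 \<le> \<epsilon> \<Longrightarrow> \<forall>X\<in>F. almost_reduces B \<epsilon> X \<Longrightarrow>
      cmod (trace_on B T) \<le> C * \<epsilon> * card B"
    using trace_on_commutator_space[OF T] by blast
  note cpt = proper_ideal_compact[OF separable infinite_dim I]
  note sys_ex = s_numbers_singular_system[OF separable infinite_dim cpt]
  obtain Z where Z: "Z \<in> I" and dom: "\<And>X n. X \<in> insert X0 F \<Longrightarrow> s_numbers X n \<le> s_numbers Z n"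
    using ideal_s_numbers_finite[OF separable infinite_dim I, of "insert X0 F"] F X0 by blast
  have "\<forall>X\<in>F. \<exists>e. singular_system X (s_numbers X) e" using sys_ex F(2) by blast
  then obtain e where e: "\<And>X. X \<in> F \<Longrightarrow> singular_system X (s_numbers X) (e X)"
    using bchoice[of F "\<lambda>X e. singular_system X (s_numbers X) e"] by blast
  obtain ez where ez: "singular_system Z (s_numbers Z) ez" using sys_ex[OF Z] by blast
  obtain e0 where e0: "singular_system X0 (s_numbers X0) e0" using sys_ex[OF X0] by blast
  define C' where "C' = (C + M) * (1 + 2 * real (card F))"
  have "cmod (\<Sum>j<n. cinner (bop_apply T (b j)) (b j)) \<le> C' * n * s_numbers Z n" if n: "n \<ge> 1" for n
  proof -
    define \<eta> where "\<eta> = s_numbers Z n"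
    have \<eta>: "0 \<le> \<eta>" unfolding \<eta>_def by (rule singular_system_nonneg[OF ez])
    \<comment> \<open>\<open>n - 1\<close> vectors are enough, because \<open>s_numbers X n\<close> is the norm on the complement of the first
      \<open>n - 1\<close> singular vectors.\<close>
    let ?J = "{..<n - 1}"
    define S where "S = (\<Union>X\<in>F. e X ` ?J \<union> bop_apply X ` e X ` ?J)"
    have finS: "finite S" using F(1) by (simp add: S_def)
    have cardS: "card S \<le> card F * (2 * n)"
      unfolding S_def
    proof (rule order_trans[OF card_UN_le[OF F(1)]], rule sum_bounded_above[of F _ "2 * n", simplified])
      fix X assume "X \<in> F"
      have "card (e X ` ?J \<union> bop_apply X ` e X ` ?J) \<le> card (e X ` ?J) + card (bop_apply X ` e X ` ?J)"
        by (rule card_Un_le)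
      moreover have "card (e X ` ?J) \<le> n" using card_image_le[of ?J "e X"] by simp
      moreover have "card (bop_apply X ` e X ` ?J) \<le> card (e X ` ?J)" by (rule card_image_le) simp
      ultimately show "card (e X ` ?J \<union> bop_apply X ` e X ` ?J) \<le> 2 * n" by linarith
    qed
    define B0 where "B0 = b ` {..<n}"
    have onb: "orthonormal {..<n} b" using b by (rule orthonormal_subset) simp
    have B0: "finite B0" "orthonormal B0 (\<lambda>x. x)" "card B0 \<le> n"
      using orthonormal_image[OF onb] card_image_le[of "{..<n}" b] by (simp_all add: B0_def)
    obtain B where B: "finite B" "B0 \<subseteq> B" "orthonormal B (\<lambda>x. x)" "card B \<le> card B0 + card S"
        "S \<subseteq> complex_vector.span B"
      using gram_schmidt[OF finS B0(1,2)] by blast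
    have one: "norm f = 1" if "f \<in> B" for f using orthonormal_norm[OF B(3) that] by simp
    have card: "real (card B) \<le> (1 + 2 * real (card F)) * n"
    proof -
      have "card B \<le> n + card F * (2 * n)" using B(4) B0(3) cardS by linarith
      then have "real (card B) \<le> real (n + card F * (2 * n))" by (rule of_nat_mono)
      then show ?thesis by (simp add: algebra_simps)
    qed
    have red: "almost_reduces B \<eta> X" if X: "X \<in> F" for X
    proof -
      have eB: "e X j \<in> complex_vector.span B" "bop_apply X (e X j) \<in> complex_vector.span B"
        if "j \<in> ?J" for j
      proof -
        have "e X j \<in> S" "bop_apply X (e X j) \<in> S" using that X unfolding S_def by blast+
        then show "e X j \<in> complex_vector.span B" "bop_apply X (e X j) \<in> complex_vector.span B"
          using B(5) by blast+
      qed
      have bound: "norm (bop_apply X v) \<le> \<eta> * norm v" if "\<And>j. j \<in> ?J \<Longrightarrow> cinner v (e X j) = 0" for v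
      proof -
        have "norm (bop_apply X v) \<le> s_numbers X (Suc (n - 1)) * norm v"
          using that by (intro singular_system_bound[OF e[OF X]]) simp
        also have "\<dots> \<le> \<eta> * norm v"
          using n dom[of X n] X by (simp add: \<eta>_def mult_right_mono)
        finally show ?thesis .
      qed
      have "norm (bop_apply X f - proj B (\<lambda>x. x) (bop_apply X f)) \<le> \<eta>" if f: "f \<in> B" for f
      proof -
        define p where "p = proj ?J (e X) f"
        have onJ: "orthonormal ?J (e X)"
          using singular_system_orthonormal[OF e[OF X]] by (rule orthonormal_subset) simp
        have "bop_apply X p \<in> complex_vector.span B"
          unfolding p_def proj_def bop_sum bop_scaleC
          by (intro complex_vector.span_sum complex_vector.span_scale eB)
        then have Xp: "proj B (\<lambda>x. x) (bop_apply X p) = bop_apply X p"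
          using proj_span[OF B(3,1)] by simp
        have "bop_apply X f = bop_apply X p + bop_apply X (f - p)" by (simp add: bop_diff)
        then have "bop_apply X f - proj B (\<lambda>x. x) (bop_apply X f) =
            bop_apply X (f - p) - proj B (\<lambda>x. x) (bop_apply X (f - p))"
          by (simp only: proj_add Xp) simp
        also have "norm \<dots> \<le> norm (bop_apply X (f - p))" by (rule norm_residual_le[OF B(3,1)])
        also have "\<dots> \<le> \<eta> * norm (f - p)"
          unfolding p_def by (intro bound cinner_residual[OF onJ]) auto
        also have "\<dots> \<le> \<eta> * 1"
          using norm_residual_le[OF onJ, of f] one[OF f] \<eta> by (intro mult_left_mono) (auto simp: p_def)
        finally show ?thesis by simp
      qed
      moreover have "norm (bop_apply X v) \<le> \<eta> * norm v" if "\<forall>f\<in>B. cinner v f = 0" for v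
        using that eB(1) by (intro bound) (auto intro: orthogonal_span)
      ultimately show ?thesis by (simp add: almost_reduces_def)
    qed
    have "trace_on B T = trace_on (B - B0) T + trace_on B0 T"
      unfolding trace_on_def by (rule sum.subset_diff[OF B(2,1)])
    moreover have "trace_on B0 T = (\<Sum>j<n. cinner (bop_apply T (b j)) (b j))"
      unfolding trace_on_def B0_def by (simp add: sum.reindex[OF orthonormal_inj_on[OF onb]])
    moreover have "cmod (trace_on B T) \<le> C * \<eta> * card B"
      using red by (intro trace B \<eta>) auto
    moreover have "cmod (trace_on (B - B0) T) \<le> M * \<eta> * card B"
    proof -
      have "cmod (cinner (bop_apply T f) f) \<le> M * \<eta>" if f: "f \<in> B - B0" for f
      proof -
        have "cinner f (b j) = 0" if "j < n" for j
        proof -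
          have "b j \<in> B" "f \<noteq> b j" "f \<in> B" using B(2) f that by (auto simp: B0_def)
          then show ?thesis using B(3) by (simp add: orthonormal_def)
        qed
        then have "norm (bop_apply T f) \<le> M * s_numbers X0 (Suc n) * norm f" by (rule tail)
        also have "\<dots> = M * s_numbers X0 (Suc n)" using one f by simp
        also have "s_numbers X0 (Suc n) \<le> s_numbers X0 n"
          using monotone_onD[OF singular_system_antimono[OF separable infinite_dim e0], of n "Suc n"] n by simp
        also have "s_numbers X0 n \<le> \<eta>" unfolding \<eta>_def by (rule dom) simp
        finally have "norm (bop_apply T f) \<le> M * \<eta>" using M by (simp add: mult_left_mono)
        then show ?thesis using cauchy_schwarz[of "bop_apply T f" f] one f by simp
      qed
      then have "cmod (trace_on (B - B0) T) \<le> (\<Sum>f\<in>B - B0. M * \<eta>)"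
        unfolding trace_on_def by (intro order_trans[OF norm_sum] sum_mono)
      also have "\<dots> \<le> M * \<eta> * card B"
        using card_mono[OF B(1), of "B - B0"] M \<eta> by (simp add: mult.commute[of _ "M * \<eta>"] mult_left_mono)
      finally show ?thesis .
    qed
    ultimately have "cmod (\<Sum>j<n. cinner (bop_apply T (b j)) (b j)) \<le> C * \<eta> * card B + M * \<eta> * card B"
      using norm_triangle_ineq4[of "trace_on B T" "trace_on (B - B0) T"] by simp
    also have "\<dots> = (C + M) * \<eta> * card B" by (simp add: algebra_simps)
    also have "\<dots> \<le> (C + M) * \<eta> * ((1 + 2 * real (card F)) * n)"
      using card F(3) M \<eta> by (intro mult_left_mono) auto
    finally show ?thesis by (simp add: C'_def \<eta>_def mult_ac)
  qed
  moreover have "0 \<le> C'" using F(3) M by (simp add: C'_def)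
  ultimately show ?thesis using Z by blast
qed

end


section \<open>Sequences\<close>

text \<open>The colours are assigned in blocks. Every stage \<open>i\<close> encodes a colour \<open>k\<close>, a multiplier \<open>m\<close> and a
counter, the last of which lets each pair \<open>(k, m)\<close> return at arbitrarily late stages. Stage \<open>i\<close> picks
\<open>l\<^sub>i \<ge> i\<close> so large that the mass of \<open>\<xi>\<close> up to \<open>N\<^sub>i = m p(l\<^sub>i)\<close> is at least \<open>i + 1\<close> times the mass up to
\<open>N\<^sub>i\<^sub>-\<^sub>1\<close>, and gives colour \<open>k\<close> to all indices in between. The other colours then share at most the
fraction \<open>1/(i + 1)\<close> of the mass up to \<open>N\<^sub>i\<close>.\<close>

lemma colouring_concentrating_mass:
  fixes \<xi> :: "nat \<Rightarrow> real" and p :: "nat \<Rightarrow> nat"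
  assumes nonneg: "\<And>j. 0 \<le> \<xi> j"
    and diverges: "filterlim (\<lambda>n. \<Sum>j=1..n. \<xi> j) at_top sequentially"
    and p: "filterlim p at_top sequentially"
  shows "\<exists>\<kappa> :: nat \<Rightarrow> nat. \<forall>k m \<epsilon> L. m \<ge> 1 \<longrightarrow> \<epsilon> > 0 \<longrightarrow>
    (\<exists>l\<ge>L. (\<Sum>j | j \<in> {1..m * p l} \<and> \<kappa> j \<noteq> k. \<xi> j) \<le> \<epsilon> * (\<Sum>j=1..m * p l. \<xi> j))"
proof -
  define S where "S = (\<lambda>n. \<Sum>j=1..n. \<xi> j)"
  have S: "filterlim S at_top sequentially" using diverges by (simp add: S_def)
  define mult where "mult = (\<lambda>i. Suc (snd (prod_decode (fst (prod_decode i)))))"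
  define colour where "colour = (\<lambda>i. fst (prod_decode (fst (prod_decode i))))"
  have "\<exists>l. \<forall>i. l i \<ge> i \<and> (\<forall>i'<i. mult i' * p (l i') < mult i * p (l i) \<and>
      (real i + 1) * S (mult i' * p (l i')) \<le> S (mult i * p (l i)))" (is "\<exists>l. \<forall>i. ?P l i (l i)")
  proof (rule dependent_wellorder_choice)
    fix r i :: nat and f g :: "nat \<Rightarrow> nat" assume "\<And>y. y < i \<Longrightarrow> f y = g y"
    then show "?P f i r = ?P g i r" by simp
  next
    fix i :: nat and f :: "nat \<Rightarrow> nat"
    have lim: "filterlim (\<lambda>l. mult i * p l) at_top sequentially"
      by (rule filterlim_at_top_mono[OF p]) (auto simp: mult_def)
    have 1: "\<forall>\<^sub>F l in sequentially. \<forall>i'\<in>{..<i}. mult i' * p (f i') < mult i * p l"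
    proof (intro eventually_ball_finite ballI)
      fix i'
      show "\<forall>\<^sub>F l in sequentially. mult i' * p (f i') < mult i * p l"
        using lim[unfolded filterlim_at_top, rule_format, of "Suc (mult i' * p (f i'))"]
        by (simp add: Suc_le_eq)
    qed simp
    have 2: "\<forall>\<^sub>F l in sequentially. \<forall>i'\<in>{..<i}. (real i + 1) * S (mult i' * p (f i')) \<le> S (mult i * p l)"
      using filterlim_compose[OF S lim] by (intro eventually_ball_finite) (auto simp: filterlim_at_top)
    have "\<forall>\<^sub>F l in sequentially. ?P f i l"
      using 1 2 eventually_ge_at_top[of i] by eventually_elim auto
    then show "\<exists>l. ?P f i l" by (rule eventually_happens'[OF sequentially_bot])
  qed
  then obtain l where l: "\<And>i. l i \<ge> i"
    and stage: "\<And>i i'. i' < i \<Longrightarrow> mult i' * p (l i') < mult i * p (l i) \<and>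
      (real i + 1) * S (mult i' * p (l i')) \<le> S (mult i * p (l i))" by blast
  define N where "N = (\<lambda>i. mult i * p (l i))"
  have N: "N i' \<le> N i" if "i' \<le> i" for i i'
    using that stage[of i' i] by (cases "i' = i") (auto simp: N_def)
  define \<kappa> where "\<kappa> = (\<lambda>j. colour (LEAST i. j \<le> N i))"
  have "\<exists>n\<ge>L. (\<Sum>j | j \<in> {1..m * p n} \<and> \<kappa> j \<noteq> k. \<xi> j) \<le> \<epsilon> * (\<Sum>j=1..m * p n. \<xi> j)"
    if m: "m \<ge> 1" and \<epsilon>: "\<epsilon> > 0" for k m \<epsilon> L
  proof -
    obtain t0 :: nat where t0: "1 / \<epsilon> \<le> real t0" using real_arch_simple by blast
    define t where "t = max t0 L"
    define i where "i = prod_encode (prod_encode (k, m - 1), t)"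
    have i: "mult i = m" "colour i = k" "t \<le> i"
      using m le_prod_encode_2[of t "prod_encode (k, m - 1)"] by (simp_all add: mult_def colour_def i_def)
    have "1 / \<epsilon> \<le> real i + 1" using t0 i(3) by (simp add: t_def)
    then have \<epsilon>i: "1 \<le> \<epsilon> * (real i + 1)" using \<epsilon> by (simp add: field_simps)
    have S0: "0 \<le> S n" for n by (simp add: S_def sum_nonneg nonneg)
    have "(\<Sum>j | j \<in> {1..N i} \<and> \<kappa> j \<noteq> k. \<xi> j) \<le> \<epsilon> * S (N i)"
    proof -
      have early: "i \<noteq> 0 \<and> j \<le> N (i - 1)" if j: "j \<le> N i" "\<kappa> j \<noteq> k" for j
      proof -
        let ?i = "LEAST i. j \<le> N i"
        have "?i \<le> i" using j(1) by (rule Least_le)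
        moreover have "?i \<noteq> i" using j(2) i(2) by (auto simp: \<kappa>_def)
        ultimately have "?i < i" by simp
        moreover have "j \<le> N ?i" using j(1) by (rule LeastI)
        moreover have "N ?i \<le> N (i - 1)" using calculation(1) by (intro N) simp
        ultimately show ?thesis by linarith
      qed
      show ?thesis
      proof (cases "i = 0")
        case True
        then have "{j. j \<in> {1..N i} \<and> \<kappa> j \<noteq> k} = {}" using early by auto
        then show ?thesis
          using \<epsilon> S0[of "N i"] by (simp only: sum.empty mult_nonneg_nonneg less_imp_le)
      next
        case False
        have "(\<Sum>j | j \<in> {1..N i} \<and> \<kappa> j \<noteq> k. \<xi> j) \<le> S (N (i - 1))"
          unfolding S_def using early by (intro sum_mono2 nonneg) auto
        also have "\<dots> \<le> \<epsilon> * ((real i + 1) * S (N (i - 1)))"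
          using mult_right_mono[OF \<epsilon>i S0[of "N (i - 1)"]] by (simp add: mult.assoc)
        also have "\<dots> \<le> \<epsilon> * S (N i)"
          using stage[of "i - 1" i] False \<epsilon> by (intro mult_left_mono) (auto simp: N_def)
        finally show ?thesis .
      qed
    qed
    moreover have "l i \<ge> L" using l[of i] i(3) by (simp add: t_def)
    ultimately show ?thesis by (intro exI[of _ "l i"]) (simp add: N_def S_def i(1))
  qed
  then show ?thesis by blast
qed

lemma nonsummable_partial_sums_at_top:
  fixes \<xi> :: "nat \<Rightarrow> real"
  assumes nonneg: "\<And>j. 0 \<le> \<xi> j" and ns: "\<not> summable \<xi>"
  shows "filterlim (\<lambda>n. \<Sum>j=1..n. \<xi> j) at_top sequentially"
proof -
  have "\<exists>n. Z \<le> (\<Sum>j=1..n. \<xi> j)" for Z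
  proof (rule ccontr)
    assume "\<nexists>n. Z \<le> (\<Sum>j=1..n. \<xi> j)"
    then have less: "(\<Sum>j=1..n. \<xi> j) < Z" for n by (simp add: not_le)
    have "(\<Sum>j<n. \<xi> j) \<le> \<xi> 0 + Z" for n
    proof -
      have "(\<Sum>j<n. \<xi> j) \<le> (\<Sum>j\<in>insert 0 {1..n}. \<xi> j)"
        by (intro sum_mono2 nonneg) auto
      then show ?thesis using less[of n] by simp
    qed
    then have "summable \<xi>" by (intro summableI_nonneg_bounded nonneg)
    then show False using ns by simp
  qed
  moreover have "(\<Sum>j=1..n. \<xi> j) \<le> (\<Sum>j=1..n'. \<xi> j)" if "n \<le> n'" for n n'
    using that by (intro sum_mono2 nonneg) auto
  ultimately show ?thesis
    unfolding filterlim_at_top eventually_sequentially by (meson order_trans)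
qed


lemma positive_if_antimono_nonsummable:
  fixes \<xi> :: "nat \<Rightarrow> real"
  assumes "\<And>n. 0 \<le> \<xi> n" "antimono_on {1..} \<xi>" "\<not> summable \<xi>" "n \<ge> 1"
  shows "0 < \<xi> n"
proof (rule ccontr)
  assume "\<not> 0 < \<xi> n"
  then have "\<xi> n = 0" using assms(1)[of n] by simp
  then have "\<xi> k = 0" if "k \<ge> n" for k
    using monotone_onD[OF assms(2), of n k] assms(1)[of k] assms(4) that by simp
  then have "summable \<xi>" by (intro summable_finite[of "{..<n}"]) (auto simp: not_less)
  then show False using assms(3) by simp
qed

text \<open>On a bounded \<open>p\<close> the values \<open>r (m * p l)\<close> would range over a finite set of positive numbers. So \<open>p\<close>
is unbounded, and therefore increasing.\<close>

lemma monoseq_at_top_if_vanishing: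
  fixes p :: "nat \<Rightarrow> nat" and r :: "nat \<Rightarrow> real"
  assumes p: "monoseq p" "\<And>l. p l \<ge> 1" and m: "m \<ge> 1"
    and r: "\<And>n. n \<ge> 1 \<Longrightarrow> 0 < r n" and lim: "(\<lambda>l. r (m * p l)) \<longlonglongrightarrow> 0"
  shows "filterlim p at_top sequentially"
proof -
  have unbounded: "\<exists>l. P < p l" for P
  proof (rule ccontr)
    assume "\<nexists>l. P < p l"
    then have le: "p l \<le> P" for l by (simp add: not_less)
    define \<delta> where "\<delta> = Min (r ` {1..m * P})"
    have mem: "m * p l \<in> {1..m * P}" for l using le[of l] p(2)[of l] m by simp
    then have ne: "{1..m * P} \<noteq> {}" by blast
    have "\<delta> > 0" using r ne by (simp add: \<delta>_def)
    then have "\<forall>\<^sub>F l in sequentially. r (m * p l) < \<delta>" using lim by (intro order_tendstoD)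
    then obtain l where "r (m * p l) < \<delta>" by (meson eventually_happens sequentially_bot)
    moreover have "\<delta> \<le> r (m * p l)" unfolding \<delta>_def using mem[of l] by (intro Min_le) auto
    ultimately show False by simp
  qed
  have "incseq p"
  proof (rule ccontr)
    assume "\<not> incseq p"
    then have "decseq p" using p(1) by (simp add: monoseq_iff)
    then show False using unbounded[of "p 0"] by (auto simp: decseq_def not_le[symmetric])
  qed
  then show ?thesis
    unfolding filterlim_at_top eventually_sequentially incseq_def
    using unbounded by (meson less_imp_le order_trans)
qed


section \<open>Quotients of infinite dimension\<close>

lemma quotient_span_cosets:
  assumes W: "complex_vector.subspace W" and A: "A \<in> quotient_span W (vcoset W ` S)"
  shows "\<exists>x\<in>complex_vector.span S. A = vcoset W x"
  using A
proof induction
  case zero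
  have "W = vcoset W 0" by (simp add: vcoset_def)
  then show ?case using complex_vector.span_zero by blast
next
  case (base A)
  then show ?case using complex_vector.span_base by blast
next
  case (add A B)
  then show ?case using coset_add_vcoset[OF W] complex_vector.span_add by blast
next
  case (scale A c)
  then show ?case using coset_scale_vcoset[OF W] complex_vector.span_scale by blast
qed

text \<open>If finitely many cosets span the quotient, then \<open>T k\<close> is congruent modulo \<open>W\<close> to some \<open>x k\<close> in the span
of a fixed finite set \<open>S\<close>. A linear relation among the \<open>x k\<close> puts the same combination of the \<open>T k\<close>
into \<open>W\<close>, so the \<open>x k\<close> are linearly independent, which is absurd for more than \<open>card S\<close> vectors.\<close>

lemma infinite_dim_quotientI:
  fixes T :: "nat \<Rightarrow> 'a::complex_vector"
  assumes W: "complex_vector.subspace W" and T: "\<And>k. T k \<in> V"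
    and indep: "\<And>K c k. finite K \<Longrightarrow> (\<Sum>k\<in>K. c k *\<^sub>C T k) \<in> W \<Longrightarrow> k \<in> K \<Longrightarrow> c k = 0"
  shows "infinite_dim_quotient V W"
  unfolding infinite_dim_quotient_def
proof
  assume "\<exists>F. finite F \<and> F \<subseteq> quotient_space V W \<and> quotient_span W F = quotient_space V W"
  then obtain S where S: "finite S" "quotient_span W (vcoset W ` S) = quotient_space V W"
    unfolding quotient_space_def by (metis finite_subset_image)
  have "\<exists>x\<in>complex_vector.span S. T k - x \<in> W" for k
  proof -
    have "vcoset W (T k) \<in> quotient_span W (vcoset W ` S)"
      using S(2) T by (simp add: quotient_space_def)
    then obtain x where x: "x \<in> complex_vector.span S" "vcoset W (T k) = vcoset W x"
      using quotient_span_cosets[OF W] by blast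
    have "T k \<in> vcoset W (T k)"
      using complex_vector.subspace_0[OF W] unfolding vcoset_def by (rule rev_image_eqI) simp
    then have "T k - x \<in> W" unfolding x(2) by (auto simp: vcoset_def)
    then show ?thesis using x(1) by blast
  qed
  then obtain x where x: "\<And>k. x k \<in> complex_vector.span S" "\<And>k. T k - x k \<in> W" by metis
  have lin: "c k = 0" if "finite K" "(\<Sum>k\<in>K. c k *\<^sub>C x k) = 0" "k \<in> K" for K c k
  proof -
    have "(\<Sum>k\<in>K. c k *\<^sub>C (T k - x k)) \<in> W"
      by (intro complex_vector.subspace_sum[OF W] complex_vector.subspace_scale[OF W] x)
    moreover have "(\<Sum>k\<in>K. c k *\<^sub>C (T k - x k)) = (\<Sum>k\<in>K. c k *\<^sub>C T k)"
      using that(2) by (simp add: complex_vector.scale_right_diff_distrib sum_subtractf)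
    ultimately show ?thesis using indep that by metis
  qed
  have inj: "inj x"
  proof (rule injI, rule ccontr)
    fix i j assume ij: "x i = x j" "i \<noteq> j"
    let ?c = "\<lambda>k. if k = i then 1 else - 1 :: complex"
    have "(\<Sum>k\<in>{i, j}. ?c k *\<^sub>C x k) = 0"
      using ij by simp
    from lin[OF _ this, of i] show False by simp
  qed
  let ?K = "{..card S}"
  have "\<not> complex_vector.dependent (x ` ?K)"
  proof (rule complex_vector.independent_if_scalars_zero)
    fix f y assume "(\<Sum>y\<in>x ` ?K. f y *\<^sub>C y) = 0" "y \<in> x ` ?K"
    then show "f y = 0"
      using lin[of ?K "\<lambda>k. f (x k)"] by (auto simp: sum.reindex[OF inj_on_subset[OF inj subset_UNIV]])
  qed simp
  moreover have "x ` ?K \<subseteq> complex_vector.span S" using x(1) by blast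
  ultimately have "card (x ` ?K) \<le> card S"
    using complex_vector.independent_span_bound[OF S(1)] by blast
  then show False using card_image[OF inj_on_subset[OF inj subset_UNIV], of ?K] by simp
qed

section \<open>The commutator space has infinite codimension\<close>

theorem corollary7p9:
  fixes I :: "'h::chilbert_space bop set"
    and \<xi> :: "nat \<Rightarrow> real" and p :: "nat \<Rightarrow> nat"
  assumes separable: "separable_space (euclidean :: 'h topology)"
    and infinite_dim: "\<not> (\<exists>B :: 'h set. finite B \<and> complex_vector.span B = UNIV)"
    and ideal: "proper_ideal I"
    and xi: "\<xi> \<in> characteristic_set I" "\<not> summable \<xi>"
    and p: "monoseq p" "\<And>l. p l \<ge> 1"
    and limit: "\<And>\<eta>. \<eta> \<in> characteristic_set I \<Longrightarrow>
      \<exists>m\<ge>1. (\<lambda>l. \<eta> (m * p l) / arith_mean \<xi> (m * p l)) \<longlonglongrightarrow> 0"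
  shows "infinite_dim_quotient I (commutator_space I)"
proof -
  note cpt = proper_ideal_compact[OF separable infinite_dim ideal]
  obtain X0 where X0: "X0 \<in> I" "\<xi> = s_numbers X0" using xi(1) by (auto simp: characteristic_set_def)
  obtain e where e: "singular_system X0 \<xi> e"
    using s_numbers_singular_system[OF separable infinite_dim cpt[OF X0(1)]] X0(2) by blast
  note on_e = singular_system_orthonormal[OF e]
  have \<xi>0: "0 \<le> \<xi> n" for n by (rule singular_system_nonneg[OF e])
  have \<xi>_pos: "0 < \<xi> n" if "n \<ge> 1" for n
    by (rule positive_if_antimono_nonsummable[OF \<xi>0 singular_system_antimono[OF separable infinite_dim e] xi(2) that])
  have S_top: "filterlim (\<lambda>n. \<Sum>j=1..n. \<xi> j) at_top sequentially"
    by (rule nonsummable_partial_sums_at_top[OF \<xi>0 xi(2)])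
  have mean_pos: "0 < arith_mean \<xi> n" if "n \<ge> 1" for n
    unfolding arith_mean_def using that \<xi>_pos by (intro divide_pos_pos sum_pos) auto
  have p_top: "filterlim p at_top sequentially"
  proof -
    obtain m where "m \<ge> 1" "(\<lambda>l. \<xi> (m * p l) / arith_mean \<xi> (m * p l)) \<longlonglongrightarrow> 0"
      using limit[OF xi(1)] by blast
    then show ?thesis
      using \<xi>_pos mean_pos by (intro monoseq_at_top_if_vanishing[OF p, of m "\<lambda>n. \<xi> n / arith_mean \<xi> n"]) auto
  qed
  obtain \<kappa> :: "nat \<Rightarrow> nat" where \<kappa>: "\<And>k m \<epsilon> L. m \<ge> 1 \<Longrightarrow> \<epsilon> > 0 \<Longrightarrow>
      \<exists>l\<ge>L. (\<Sum>j | j \<in> {1..m * p l} \<and> \<kappa> j \<noteq> k. \<xi> j) \<le> \<epsilon> * (\<Sum>j=1..m * p l. \<xi> j)"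
    using colouring_concentrating_mass[OF \<xi>0 S_top p_top] by blast

  obtain b :: "nat \<Rightarrow> 'h" where "orthonormal_basis b"
    using exists_orthonormal_basis[OF separable infinite_dim] by blast
  then have b: "orthonormal UNIV b" by (simp add: orthonormal_basis_def)
  \<comment> \<open>The vectors \<open>g j\<close> are the left singular vectors: \<open>X0\<close> maps \<open>e j\<close> to \<open>\<xi> (Suc j)\<close> times \<open>g j\<close>. Moving both
    sequences to \<open>b\<close> and masking the indices of the other colours turns \<open>X0\<close> into \<open>T k\<close>.\<close>
  define g where "g = (\<lambda>j. (1 / complex_of_real (\<xi> (Suc j))) *\<^sub>C bop_apply X0 (e j))"
  have g: "orthonormal UNIV g"
    using singular_system_cinner_image[OF separable infinite_dim e] \<xi>_pos
    by (simp add: orthonormal_def g_def cinner_scaleC_left cinner_scaleC_right power2_eq_square less_imp_neq[symmetric])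
  have X0_e: "bop_apply X0 (e j) = complex_of_real (\<xi> (Suc j)) *\<^sub>C g j" for j
    using \<xi>_pos[of "Suc j"] by (simp add: g_def scaleC_scaleC scaleC_one)
  obtain C where C: "\<And>x i. cinner (bop_apply C x) (e i) = cinner x (b i)"
      "\<And>i. bop_apply C (b i) = e i" "\<And>x. norm (bop_apply C x) \<le> norm x"
    using diagonal_map_exists[OF b on_e, of "\<lambda>_. 1" 1] by (auto simp: scaleC_one)
  have "\<exists>A. (\<forall>j. bop_apply A (g j) = (if \<kappa> (Suc j) = k then 1 else 0) *\<^sub>C b j) \<and>
      (\<forall>x. norm (bop_apply A x) \<le> norm x)" for k
  proof -
    have "cmod (if \<kappa> (Suc j) = k then 1 else 0) \<le> 1" for j by simp
    from diagonal_map_exists[OF g b, of "\<lambda>j. if \<kappa> (Suc j) = k then 1 else 0", OF this]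
    show ?thesis unfolding mult_1 by (elim exE conjE) (intro exI conjI)
  qed
  then obtain A where A: "\<And>k j. bop_apply (A k) (g j) = (if \<kappa> (Suc j) = k then 1 else 0) *\<^sub>C b j"
      "\<And>k x. norm (bop_apply (A k) x) \<le> norm x" by metis
  define T where "T = (\<lambda>k. A k * (X0 * C))"
  have TI: "T k \<in> I" for k using ideal X0(1) by (simp add: T_def proper_ideal_def)
  have T_b: "bop_apply (T k) (b j) = complex_of_real (if \<kappa> (Suc j) = k then \<xi> (Suc j) else 0) *\<^sub>C b j" for k j
    by (simp add: T_def C(2) X0_e bop_scaleC A(1) scaleC_scaleC scaleC_one)
  have T_tail: "norm (bop_apply (T k) v) \<le> \<xi> (Suc n) * norm v" if "\<And>j. j < n \<Longrightarrow> cinner v (b j) = 0" for k n v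
  proof -
    have "norm (bop_apply (T k) v) \<le> norm (bop_apply X0 (bop_apply C v))" using A(2) by (simp add: T_def)
    also have "\<dots> \<le> \<xi> (Suc n) * norm (bop_apply C v)"
      using that by (intro singular_system_bound[OF e]) (simp add: C(1))
    also have "\<dots> \<le> \<xi> (Suc n) * norm v" by (intro mult_left_mono C(3) \<xi>0)
    finally show ?thesis .
  qed

  show ?thesis
  proof (rule infinite_dim_quotientI)
    show "complex_vector.subspace (commutator_space I)"
      unfolding commutator_space_def by (rule complex_vector.subspace_span)
    show "T k \<in> I" for k by (rule TI)
    fix K :: "nat set" and c k0
    assume K: "finite K" and W: "(\<Sum>k\<in>K. c k *\<^sub>C T k) \<in> commutator_space I" and k0: "k0 \<in> K"
    define R where "R = (\<Sum>k\<in>K. c k *\<^sub>C T k)"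
    define M where "M = (\<Sum>k\<in>K. cmod (c k))"
    \<comment> \<open>\<open>d j * \<xi> j\<close> is the \<open>j\<close>-th diagonal entry of \<open>R\<close>.\<close>
    define d where "d = (\<lambda>j. if \<kappa> j \<in> K then c (\<kappa> j) else 0)"
    have M0: "0 \<le> M" by (simp add: M_def sum_nonneg)
    have c_le: "cmod (c k) \<le> M" if "k \<in> K" for k
      unfolding M_def using K that by (intro member_le_sum) auto
    have d_le: "cmod (d j) \<le> M" for j using c_le M0 by (simp add: d_def)
    have R_tail: "norm (bop_apply R v) \<le> M * \<xi> (Suc n) * norm v" if "\<And>j. j < n \<Longrightarrow> cinner v (b j) = 0" for n v
    proof -
      have "norm (bop_apply R v) \<le> (\<Sum>k\<in>K. norm (c k *\<^sub>C bop_apply (T k) v))"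
        unfolding R_def bop_apply_sum scaleC_bop.rep_eq by (rule norm_sum)
      also have "\<dots> \<le> (\<Sum>k\<in>K. cmod (c k) * (\<xi> (Suc n) * norm v))"
        unfolding norm_scaleC using that by (intro sum_mono mult_left_mono T_tail) auto
      finally show ?thesis by (simp add: M_def sum_distrib_right mult.assoc)
    qed
    have R_diag: "cinner (bop_apply R (b j)) (b j) = d (Suc j) * complex_of_real (\<xi> (Suc j))" for j
    proof -
      have "cinner (b j) (b j) = 1" using b by (simp add: orthonormal_def)
      then have "cinner (bop_apply R (b j)) (b j) =
          (\<Sum>k\<in>K. if \<kappa> (Suc j) = k then c k * complex_of_real (\<xi> (Suc j)) else 0)"
        unfolding R_def bop_apply_sum scaleC_bop.rep_eq T_b cinner_sum_left cinner_scaleC_left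
        by (intro sum.cong) auto
      then show ?thesis using K by (simp add: d_def sum.delta)
    qed
    obtain Z C' where Z: "Z \<in> I" and C': "0 \<le> C'"
      and est: "\<And>n. n \<ge> 1 \<Longrightarrow> cmod (\<Sum>j<n. cinner (bop_apply R (b j)) (b j)) \<le> C' * n * s_numbers Z n"
      using commutator_space_diagonal_estimate[OF separable infinite_dim ideal _ X0(1) b M0, of R]
        W R_tail unfolding R_def X0(2) by blast
    have upper: "cmod (\<Sum>j=1..n. d j * complex_of_real (\<xi> j)) \<le> C' * n * s_numbers Z n" if "n \<ge> 1" for n
    proof -
      have "(\<Sum>j<n. cinner (bop_apply R (b j)) (b j)) = (\<Sum>j=1..n. d j * complex_of_real (\<xi> j))"
        unfolding R_diag by (rule sum.reindex_bij_witness[of _ "\<lambda>j. j - 1" Suc]) auto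
      then show ?thesis using est[OF that] by simp
    qed
    show "c k0 = 0"
    proof (rule ccontr)
      assume c0: "c k0 \<noteq> 0"
      have M_pos: "0 < M" using c_le[OF k0] c0 by (smt (verit) zero_less_norm_iff)
      have "s_numbers Z \<in> characteristic_set I" using Z by (simp add: characteristic_set_def)
      then obtain m where m: "m \<ge> 1"
        and ratio: "(\<lambda>l. s_numbers Z (m * p l) / arith_mean \<xi> (m * p l)) \<longlonglongrightarrow> 0"
        using limit by blast
      have "(\<lambda>l. C' * (s_numbers Z (m * p l) / arith_mean \<xi> (m * p l))) \<longlonglongrightarrow> 0"
        using tendsto_mult_right_zero[OF ratio] .
      then have "\<forall>\<^sub>F l in sequentially.
          C' * (s_numbers Z (m * p l) / arith_mean \<xi> (m * p l)) < cmod (c k0) / 2"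
        using c0 by (intro order_tendstoD) auto
      then obtain L where L: "\<And>l. l \<ge> L \<Longrightarrow>
          C' * (s_numbers Z (m * p l) / arith_mean \<xi> (m * p l)) < cmod (c k0) / 2"
        by (auto simp: eventually_sequentially)
      \<comment> \<open>The coefficients of the other colours differ from \<open>c k0\<close> by at most \<open>2 * M\<close>, so this \<open>\<epsilon>\<close> lets
        them cancel no more than half of the contribution of \<open>k0\<close>.\<close>
      define \<epsilon> where "\<epsilon> = cmod (c k0) / (4 * M)"
      have "\<epsilon> > 0" using c0 M_pos by (simp add: \<epsilon>_def)
      then obtain l where l: "l \<ge> L"
        and mass: "(\<Sum>j | j \<in> {1..m * p l} \<and> \<kappa> j \<noteq> k0. \<xi> j) \<le> \<epsilon> * (\<Sum>j=1..m * p l. \<xi> j)"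
        using \<kappa>[OF m] by blast
      define n where "n = m * p l"
      have n: "n \<ge> 1" using m p(2)[of l] by (simp add: n_def)
      define S where "S = (\<Sum>j=1..n. \<xi> j)"
      have S0: "0 \<le> S" unfolding S_def by (simp add: sum_nonneg \<xi>0)
      let ?J = "{j. j \<in> {1..n} \<and> \<kappa> j \<noteq> k0}"
      have "(\<Sum>j=1..n. d j * complex_of_real (\<xi> j)) =
          (\<Sum>j=1..n. c k0 * complex_of_real (\<xi> j)) + (\<Sum>j=1..n. (d j - c k0) * complex_of_real (\<xi> j))"
        by (simp add: algebra_simps flip: sum.distrib)
      also have "(\<Sum>j=1..n. (d j - c k0) * complex_of_real (\<xi> j)) = (\<Sum>j\<in>?J. (d j - c k0) * complex_of_real (\<xi> j))"
        by (rule sum.mono_neutral_right) (use k0 in \<open>auto simp: d_def\<close>)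
      also have "(\<Sum>j=1..n. c k0 * complex_of_real (\<xi> j)) = c k0 * complex_of_real S"
        by (simp add: S_def sum_distrib_left)
      finally have split: "(\<Sum>j=1..n. d j * complex_of_real (\<xi> j)) =
          c k0 * complex_of_real S + (\<Sum>j\<in>?J. (d j - c k0) * complex_of_real (\<xi> j))" .
      have "cmod y \<le> cmod x + cmod z" if "x = y + z" for x y z :: complex
        using norm_triangle_ineq4[of x z] that by simp
      from this[OF split] have "cmod (c k0 * complex_of_real S) \<le>
          cmod (\<Sum>j=1..n. d j * complex_of_real (\<xi> j)) + cmod (\<Sum>j\<in>?J. (d j - c k0) * complex_of_real (\<xi> j))" .
      moreover have "cmod (\<Sum>j\<in>?J. (d j - c k0) * complex_of_real (\<xi> j)) \<le> (\<Sum>j\<in>?J. 2 * M * \<xi> j)"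
      proof (intro order_trans[OF norm_sum] sum_mono)
        fix j
        have "cmod (d j - c k0) \<le> 2 * M"
          using norm_triangle_ineq4[of "d j" "c k0"] d_le[of j] c_le[OF k0] by linarith
        then show "cmod ((d j - c k0) * complex_of_real (\<xi> j)) \<le> 2 * M * \<xi> j"
          using \<xi>0[of j] by (simp add: norm_mult mult_right_mono)
      qed
      moreover have "(\<Sum>j\<in>?J. 2 * M * \<xi> j) \<le> 2 * M * (\<epsilon> * S)"
        using mass M0 unfolding sum_distrib_left[symmetric] by (intro mult_left_mono) (auto simp: n_def S_def)
      moreover have "2 * M * (\<epsilon> * S) = cmod (c k0) / 2 * S" using M_pos by (simp add: \<epsilon>_def)
      moreover have "cmod (c k0 * complex_of_real S) = cmod (c k0) * S" using S0 by (simp add: norm_mult)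
      ultimately have "cmod (c k0) / 2 * S \<le> C' * n * s_numbers Z n"
        using upper[OF n] by simp
      moreover have "S = n * arith_mean \<xi> n" using n by (simp add: S_def arith_mean_def)
      ultimately have "n * (cmod (c k0) / 2 * arith_mean \<xi> n) \<le> n * (C' * s_numbers Z n)"
        by (simp add: mult_ac)
      then have "cmod (c k0) / 2 * arith_mean \<xi> n \<le> C' * s_numbers Z n" using n by simp
      then have "cmod (c k0) / 2 \<le> C' * (s_numbers Z n / arith_mean \<xi> n)"
        using mean_pos[OF n] by (simp add: pos_le_divide_eq)
      then show False using L[OF l] by (simp add: n_def)
    qed
  qed
qed

end
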